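(* Let $r,n\ge2$, $\pi\in\mathbb{S}_{2rn}$ a product of $n$ disjoint $2r$-cycles, $\mathcal{C}$ its conjugacy class, and $\rho$ an irreducible representation of $\mathbb{S}_{2rn}^\pi$ with $\deg\rho>1$. Then $\dim\mathfrak{B}(\mathcal{C},\rho)=\infty$.
   Context: For a finite group $G$, a conjugacy class $\mathcal{C}$, a fixed $s\in\mathcal{C}$ with centralizer $G^s$ and an irreducible representation $(\rho,V)$ of $G^s$, $M(\mathcal{C},\rho)$ is the irreducible Yetter–Drinfeld module over $\mathbb{C}G$: enumerate $\mathcal{C}=\{t_1=s,\dots,t_M\}$, choose $g_i\in G$ with $g_isg_i^{-1}=t_i$; $M(\mathcal{C},\rho)=\bigoplus_i g_i\otimes V$ with grading $\deg(g_i\otimes v)=t_i$, action $g\cdot(g_i\otimes v)=g_j\otimes\rho(\gamma)v$ where $gg_i=g_j\gamma$, $\gamma\in G^s$, and braiding $c((g_i\otimes v)\otimes(g_j\otimes w))=(g_h\otimes\rho(\gamma)w)\otimes(g_i\otimes v)$ where $t_ig_j=g_h\gamma$. $\mathfrak{B}(\mathcal{C},\rho)$ is the Nichols algebra of this braided vector space. $\deg\rho$ is the dimension of $V$. *)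

theory Defs
  imports Complex_Main "HOL-Library.Function_Algebras" "HOL-Library.Extended_Nat" "HOL-Combinatorics.Permutations"
begin

type_synonym perm = "nat \<Rightarrow> nat"
type_synonym bas = "perm \<times> nat"   (* basis vector g_t \<otimes> e_k is indexed by (t, k) *)

definition Sym :: "nat \<Rightarrow> perm set" where
  "Sym N = {p. p permutes {..<N}}"

definition cycle_type_2r :: "nat \<Rightarrow> nat \<Rightarrow> perm \<Rightarrow> bool" where
  "cycle_type_2r r n p \<longleftrightarrow> p \<in> Sym (2*r*n) \<and>
     (\<forall>x<2*r*n. (p ^^ (2*r)) x = x \<and> (\<forall>k. 0 < k \<and> k < 2*r \<longrightarrow> (p ^^ k) x \<noteq> x))"

definition conj_class :: "nat \<Rightarrow> perm \<Rightarrow> perm set" where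
  "conj_class N s = {\<sigma> \<circ> s \<circ> inv \<sigma> | \<sigma>. \<sigma> \<in> Sym N}"

definition centralizer :: "nat \<Rightarrow> perm \<Rightarrow> perm set" where
  "centralizer N s = {g \<in> Sym N. g \<circ> s = s \<circ> g}"

definition dmult :: "nat \<Rightarrow> (nat \<Rightarrow> nat \<Rightarrow> complex) \<Rightarrow> (nat \<Rightarrow> nat \<Rightarrow> complex) \<Rightarrow> (nat \<Rightarrow> nat \<Rightarrow> complex)" where
  "dmult d A B = (\<lambda>i j. \<Sum>k<d. A i k * B k j)"

definition dapply :: "nat \<Rightarrow> (nat \<Rightarrow> nat \<Rightarrow> complex) \<Rightarrow> (nat \<Rightarrow> complex) \<Rightarrow> (nat \<Rightarrow> complex)" where
  "dapply d A v = (\<lambda>i. if i < d then (\<Sum>k<d. A i k * v k) else 0)"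

definition cvec :: "nat \<Rightarrow> (nat \<Rightarrow> complex) set" where
  "cvec d = {v. \<forall>i\<ge>d. v i = 0}"

definition csubspace :: "nat \<Rightarrow> (nat \<Rightarrow> complex) set \<Rightarrow> bool" where
  "csubspace d W \<longleftrightarrow> W \<subseteq> cvec d \<and> (\<lambda>_. 0) \<in> W \<and>
     (\<forall>v\<in>W. \<forall>w\<in>W. (\<lambda>i. v i + w i) \<in> W) \<and> (\<forall>c. \<forall>v\<in>W. (\<lambda>i. c * v i) \<in> W)"

definition is_rep :: "perm set \<Rightarrow> nat \<Rightarrow> (perm \<Rightarrow> nat \<Rightarrow> nat \<Rightarrow> complex) \<Rightarrow> bool" where
  "is_rep H d \<rho> \<longleftrightarrow> id \<in> H \<and> (\<forall>i<d. \<forall>j<d. \<rho> id i j = (if i = j then 1 else 0)) \<and>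
     (\<forall>g\<in>H. \<forall>h\<in>H. \<forall>i<d. \<forall>j<d. \<rho> (g \<circ> h) i j = dmult d (\<rho> g) (\<rho> h) i j)"

definition irreducible_rep :: "perm set \<Rightarrow> nat \<Rightarrow> (perm \<Rightarrow> nat \<Rightarrow> nat \<Rightarrow> complex) \<Rightarrow> bool" where
  "irreducible_rep H d \<rho> \<longleftrightarrow> is_rep H d \<rho> \<and> d > 0 \<and>
     (\<forall>W. csubspace d W \<and> (\<forall>g\<in>H. \<forall>v\<in>W. dapply d (\<rho> g) v \<in> W) \<longrightarrow>
        W = {\<lambda>_. 0} \<or> W = cvec d)"

text \<open>Basis of M(C,rho) and of its tensor powers.\<close>
definition Bas :: "perm set \<Rightarrow> nat \<Rightarrow> bas set" where
  "Bas C d = C \<times> {..<d}"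

definition Wd :: "perm set \<Rightarrow> nat \<Rightarrow> nat \<Rightarrow> bas list set" where
  "Wd C d m = {w. length w = m \<and> set w \<subseteq> Bas C d}"

text \<open>Matrix (w.r.t. the tensor basis) of the braiding c acting on tensor positions i, i+1.
  Here g t is the chosen element with g t \<circ> s \<circ> inv (g t) = t; for x = g_t \<otimes> e_a and
  y = g_u \<otimes> e_b: t g_u = g_h \<gamma> with h = t u t^-1, \<gamma> = g_h^-1 t g_u, and
  c(x \<otimes> y) = (g_h \<otimes> \<rho>(\<gamma>) e_b) \<otimes> x.\<close>
definition braid_mat :: "(perm \<Rightarrow> perm) \<Rightarrow> (perm \<Rightarrow> nat \<Rightarrow> nat \<Rightarrow> complex) \<Rightarrow> nat
    \<Rightarrow> bas list \<Rightarrow> bas list \<Rightarrow> complex" where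
  "braid_mat g \<rho> i w w' =
     (let t = fst (w' ! i); u = fst (w' ! (i+1)); b = snd (w' ! (i+1));
          h = t \<circ> u \<circ> inv t; \<gamma> = inv (g h) \<circ> t \<circ> g u
      in if take i w = take i w' \<and> drop (i+2) w = drop (i+2) w' \<and>
            w ! (i+1) = w' ! i \<and> fst (w ! i) = h
         then \<rho> \<gamma> (snd (w ! i)) b else 0)"

definition tmult :: "bas list set \<Rightarrow> (bas list \<Rightarrow> bas list \<Rightarrow> complex) \<Rightarrow> (bas list \<Rightarrow> bas list \<Rightarrow> complex)
    \<Rightarrow> (bas list \<Rightarrow> bas list \<Rightarrow> complex)" where
  "tmult S A B = (\<lambda>w w'. \<Sum>v\<in>S. A w v * B v w')"

definition tid :: "bas list \<Rightarrow> bas list \<Rightarrow> complex" where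
  "tid = (\<lambda>w w'. if w = w' then 1 else 0)"

definition ext_id :: "(bas list \<Rightarrow> bas list \<Rightarrow> complex) \<Rightarrow> (bas list \<Rightarrow> bas list \<Rightarrow> complex)" where
  "ext_id A = (\<lambda>w w'. if last w = last w' then A (butlast w) (butlast w') else 0)"

text \<open>On V^(m+1) (positions 0..m): c_(m-1) c_(m-2) ... c_(m-k), where c_j acts on positions j, j+1.\<close>
fun braid_chain :: "perm set \<Rightarrow> nat \<Rightarrow> (perm \<Rightarrow> perm) \<Rightarrow> (perm \<Rightarrow> nat \<Rightarrow> nat \<Rightarrow> complex)
    \<Rightarrow> nat \<Rightarrow> nat \<Rightarrow> (bas list \<Rightarrow> bas list \<Rightarrow> complex)" where
  "braid_chain C d g \<rho> m 0 = tid"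
| "braid_chain C d g \<rho> m (Suc k) =
     tmult (Wd C d (Suc m)) (braid_chain C d g \<rho> m k) (braid_mat g \<rho> (m - 1 - k))"

text \<open>Quantum symmetrizer: QS_0 = id, QS_(m+1) = (QS_m \<otimes> id) T_(m+1) with
  T_(m+1) = id + c_m + c_m c_(m-1) + ... + c_m ... c_1 (1-based braiding indices).\<close>
fun quantum_symmetrizer :: "perm set \<Rightarrow> nat \<Rightarrow> (perm \<Rightarrow> perm) \<Rightarrow> (perm \<Rightarrow> nat \<Rightarrow> nat \<Rightarrow> complex)
    \<Rightarrow> nat \<Rightarrow> (bas list \<Rightarrow> bas list \<Rightarrow> complex)" where
  "quantum_symmetrizer C d g \<rho> 0 = tid"
| "quantum_symmetrizer C d g \<rho> (Suc m) =
     tmult (Wd C d (Suc m)) (ext_id (quantum_symmetrizer C d g \<rho> m))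
       (\<lambda>w w'. \<Sum>k\<le>m. braid_chain C d g \<rho> m k w w')"

definition tapply :: "bas list set \<Rightarrow> (bas list \<Rightarrow> bas list \<Rightarrow> complex) \<Rightarrow> (bas list \<Rightarrow> complex)
    \<Rightarrow> (bas list \<Rightarrow> complex)" where
  "tapply S A f = (\<lambda>w. if w \<in> S then (\<Sum>w'\<in>S. A w w' * f w') else 0)"

text \<open>dim of the degree-m component B^m = V^(\<otimes>m) / ker QS_m, i.e. the rank of QS_m.\<close>
definition nichols_component_dim :: "perm set \<Rightarrow> nat \<Rightarrow> (perm \<Rightarrow> perm) \<Rightarrow> (perm \<Rightarrow> nat \<Rightarrow> nat \<Rightarrow> complex)
    \<Rightarrow> nat \<Rightarrow> nat" where
  "nichols_component_dim C d g \<rho> m =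
     vector_space.dim (\<lambda>(c::complex) (f :: bas list \<Rightarrow> complex) x. c * f x)
       (range (tapply (Wd C d m) (quantum_symmetrizer C d g \<rho> m)))"

definition nichols_dim :: "perm set \<Rightarrow> nat \<Rightarrow> (perm \<Rightarrow> perm) \<Rightarrow> (perm \<Rightarrow> nat \<Rightarrow> nat \<Rightarrow> complex) \<Rightarrow> enat" where
  "nichols_dim C d g \<rho> = (SUP N. enat (\<Sum>m<N. nichols_component_dim C d g \<rho> m))"

end

theory Submission
  imports Defs
begin

text \<open>
  The Nichols algebra is infinite-dimensional as soon as infinitely many quantum symmetrizers are
  nonzero. Pairwise commuting conjugates \<open>t i\<close> of \<open>\<pi>\<close>, together with eigenvectors in their
  components, span a subspace on which the braiding is diagonal with some matrix \<open>q\<close>, and there the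
  quantum symmetrizer is detected by iterated skew derivations of the free algebra. Let \<open>z\<close> be
  homogeneous of a degree with self-braiding 1, and let \<open>P\<close> be a word of skew derivations
  such that all of them but the one applied first kill \<open>z\<close>, and \<open>P z\<close> is a nonzero constant. Then
  \<open>P (z ^ k) = k (P z) z ^ (k - 1)\<close>, so no power of \<open>z\<close> vanishes in the Nichols algebra.

  By Schur's lemma \<open>\<pi>\<close> acts by a scalar \<open>c\<close>. If \<open>c = 1\<close>, take for \<open>z\<close> a single letter. If
  \<open>c \<noteq> 1, -1\<close>, take the bracket of two letters at \<open>\<pi>\<close> and its inverse. If \<open>c = -1\<close>, let \<open>u\<close> be an
  involution of the centralizer that interchanges two cycles. As the cycles have even length, applying
  \<open>u\<close> at every other point conjugates \<open>\<pi>\<close> to \<open>\<pi> u\<close>. If \<open>u\<close> does not act by a scalar, it has both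
  eigenvalues, and suitable eigenvectors at \<open>\<pi>\<close>, \<open>\<pi> u\<close> and their inverses (four distinct
  elements, because \<open>r \<ge> 2\<close>) form the affine diagram of type \<open>A_3\<close> at \<open>-1\<close>; an iterated bracket
  whose degree is the null root serves as \<open>z\<close>. If all such \<open>u\<close> act by scalars, then modulo
  scalars the centralizer acts through the powers of a single cycle, whose eigenvectors span
  invariant lines, so \<open>\<rho>\<close> has degree 1.
\<close>

section \<open>Skew derivations of the free algebra\<close>

text \<open>A polynomial is given by its coefficients on words. No finite support is imposed, so
  these are formal series in noncommuting letters; the degree \<open>m\<close> part is what words of
  length \<open>m\<close> see.\<close>

type_synonym wpoly = "nat list \<Rightarrow> complex"

definition scale :: "complex \<Rightarrow> wpoly \<Rightarrow> wpoly" where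
  "scale c f = (\<lambda>w. c * f w)"

definition unit_poly :: wpoly where
  "unit_poly w = (if w = [] then 1 else 0)"

definition letter :: "nat \<Rightarrow> wpoly" where
  "letter i w = (if w = [i] then 1 else 0)"

text \<open>Concatenation product, i.e. the sum over all cuts of the word. Peeling the first letter
  replaces the left factor by a residual series, so inductions on the word generalize
  \<open>f\<close>.\<close>

primrec conv :: "wpoly \<Rightarrow> wpoly \<Rightarrow> wpoly" where
  "conv f g [] = f [] * g []"
| "conv f g (a # w) = f [] * g (a # w) + conv (\<lambda>u. f (a # u)) g w"

definition wt :: "(nat \<Rightarrow> nat \<Rightarrow> complex) \<Rightarrow> nat \<Rightarrow> nat list \<Rightarrow> complex" where
  "wt q i w = (\<Prod>j\<leftarrow>w. q i j)"

text \<open>Algebra automorphism describing how the degree of letter \<open>i\<close> acts: it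
  rescales letter \<open>j\<close> by \<open>q i j\<close>.\<close>

definition twist :: "(nat \<Rightarrow> nat \<Rightarrow> complex) \<Rightarrow> nat \<Rightarrow> wpoly \<Rightarrow> wpoly" where
  "twist q i f = (\<lambda>w. wt q i w * f w)"

text \<open>Right skew derivation: an occurrence of \<open>i\<close> is braided past all letters to
  its right and then removed, which explains the weight.\<close>

primrec skew_der :: "(nat \<Rightarrow> nat \<Rightarrow> complex) \<Rightarrow> nat \<Rightarrow> wpoly \<Rightarrow> wpoly" where
  "skew_der q i f [] = f [i]"
| "skew_der q i f (a # w) = wt q i (a # w) * f (i # a # w) + skew_der q i (\<lambda>u. f (a # u)) w"

primrec skew_ders :: "(nat \<Rightarrow> nat \<Rightarrow> complex) \<Rightarrow> nat list \<Rightarrow> wpoly \<Rightarrow> wpoly" where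
  "skew_ders q [] f = f"
| "skew_ders q (i # ks) f = skew_ders q ks (skew_der q i f)"

primrec conv_power :: "wpoly \<Rightarrow> nat \<Rightarrow> wpoly" where
  "conv_power z 0 = unit_poly"
| "conv_power z (Suc k) = conv z (conv_power z k)"

section \<open>Laws of the product, the twists and the skew derivations\<close>

lemma wt_simps [simp]:
  "wt q i [] = 1" "wt q i (a # w) = q i a * wt q i w" "wt q i (u @ w) = wt q i u * wt q i w"
  by (simp_all add: wt_def)

lemma scale_simps [simp]:
  "scale 1 f = f" "scale 0 f = 0" "scale c 0 = 0" "scale c (scale e f) = scale (c * e) f"
  by (auto simp: scale_def fun_eq_iff)

lemma conv_add_left: "conv (f + f') g = conv f g + conv f' g"
proof
  fix w show "conv (f + f') g w = (conv f g + conv f' g) w"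
    by (induction w arbitrary: f f')
      (auto simp: algebra_simps plus_fun_def)
qed

lemma conv_add_right: "conv f (g + g') = conv f g + conv f g'"
proof
  fix w show "conv f (g + g') w = (conv f g + conv f g') w"
    by (induction w arbitrary: f) (auto simp: algebra_simps plus_fun_def)
qed

lemma conv_scale_left [simp]: "conv (scale c f) g = scale c (conv f g)"
proof
  fix w show "conv (scale c f) g w = scale c (conv f g) w"
    by (induction w arbitrary: f) (auto simp: algebra_simps scale_def)
qed

lemma conv_scale_right [simp]: "conv f (scale c g) = scale c (conv f g)"
proof
  fix w show "conv f (scale c g) w = scale c (conv f g) w"
    by (induction w arbitrary: f) (auto simp: algebra_simps scale_def)
qed

lemma conv_zero [simp]: "conv 0 g = 0" "conv f 0 = 0"
  using conv_scale_left[of 0 0 g] conv_scale_right[of f 0 0] by auto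

lemma conv_unit [simp]: "conv unit_poly f = f" "conv f unit_poly = f"
proof -
  have *: "(\<lambda>u. unit_poly (a # u)) = 0" for a
    by (auto simp: unit_poly_def)
  show "conv unit_poly f = f"
  proof
    fix w
    show "conv unit_poly f w = f w"
    proof (cases w)
      case (Cons a u)
      have "conv unit_poly f (a # u) = unit_poly [] * f (a # u) + conv (\<lambda>u. unit_poly (a # u)) f u"
        by simp
      also have "\<dots> = f (a # u)" unfolding * conv_zero by (simp add: unit_poly_def)
      finally show ?thesis using Cons by simp
    qed (simp add: unit_poly_def)
  qed
  show "conv f unit_poly = f"
  proof
    fix w show "conv f unit_poly w = f w"
      by (induction w arbitrary: f) (auto simp: unit_poly_def)
  qed
qed

lemma twist_add: "twist q i (f + g) = twist q i f + twist q i g"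
  by (auto simp: twist_def algebra_simps)

lemma twist_scale [simp]: "twist q i (scale c f) = scale c (twist q i f)"
  by (auto simp: twist_def scale_def)

lemma twist_unit [simp]: "twist q i unit_poly = unit_poly"
  by (auto simp: twist_def unit_poly_def)

lemma twist_letter [simp]: "twist q i (letter j) = scale (q i j) (letter j)"
  by (auto simp: twist_def letter_def scale_def)

lemma twist_conv: "twist q i (conv f g) = conv (twist q i f) (twist q i g)"
proof
  fix w show "twist q i (conv f g) w = conv (twist q i f) (twist q i g) w"
  proof (induction w arbitrary: f)
    case (Cons a w)
    have *: "(\<lambda>u. twist q i f (a # u)) = scale (q i a) (twist q i (\<lambda>u. f (a # u)))"
      by (auto simp: twist_def scale_def)
    have "conv (twist q i f) (twist q i g) (a # w) = f [] * twist q i g (a # w)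
        + q i a * twist q i (conv (\<lambda>u. f (a # u)) g) w"
      unfolding conv.simps * conv_scale_left Cons by (simp add: scale_def twist_def)
    then show ?case by (simp add: twist_def algebra_simps)
  qed (simp add: twist_def)
qed

lemma skew_der_add: "skew_der q i (f + g) = skew_der q i f + skew_der q i g"
proof
  fix w show "skew_der q i (f + g) w = (skew_der q i f + skew_der q i g) w"
    by (induction w arbitrary: f g) (auto simp: algebra_simps plus_fun_def)
qed

lemma skew_der_scale [simp]: "skew_der q i (scale c f) = scale c (skew_der q i f)"
proof
  fix w show "skew_der q i (scale c f) w = scale c (skew_der q i f) w"
    by (induction w arbitrary: f) (auto simp: algebra_simps scale_def)
qed

lemma skew_der_zero [simp]: "skew_der q i 0 = 0"
  using skew_der_scale[of q i 0 0] by simp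

lemma skew_der_unit [simp]: "skew_der q i unit_poly = 0"
proof
  fix w show "skew_der q i unit_poly w = 0 w"
    by (cases w) (use skew_der_zero in \<open>auto simp: unit_poly_def zero_fun_def\<close>)
qed

lemma skew_der_letter [simp]: "skew_der q i (letter j) = (if i = j then unit_poly else 0)"
proof
  fix w show "skew_der q i (letter j) w = (if i = j then unit_poly else 0) w"
  proof (cases w)
    case (Cons a u)
    have "(\<lambda>u. letter j (a # u)) = (if a = j then unit_poly else 0)"
      by (auto simp: letter_def unit_poly_def)
    then show ?thesis using Cons by (auto simp: letter_def unit_poly_def)
  qed (auto simp: letter_def unit_poly_def)
qed

text \<open>Twisted Leibniz rule: an occurrence of \<open>i\<close> inside \<open>f\<close> must
  pass the whole of \<open>g\<close> before it is removed, whence the twist.\<close>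

lemma skew_der_conv:
  "skew_der q i (conv f g) = conv f (skew_der q i g) + conv (skew_der q i f) (twist q i g)"
proof
  fix w
  show "skew_der q i (conv f g) w
    = (conv f (skew_der q i g) + conv (skew_der q i f) (twist q i g)) w"
  proof (induction w arbitrary: f)
    case Nil
    then show ?case by (simp add: twist_def)
  next
    case (Cons a w)
    let ?fa = "\<lambda>u. f (a # u)" and ?fia = "\<lambda>u. f (i # a # u)"
    have 1: "(\<lambda>u. conv f g (a # u)) = scale (f []) (\<lambda>u. g (a # u)) + conv ?fa g"
      by (auto simp: scale_def)
    have 2: "(\<lambda>u. skew_der q i f (a # u)) = scale (q i a) (twist q i ?fia) + skew_der q i ?fa"
      by (auto simp: scale_def twist_def)
    \<comment> \<open>These are the terms where \<open>i\<close> stands at the very front of the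
      word; multiplicativity of the twist distributes their weight over both factors.\<close>
    have 3: "conv (twist q i ?fia) (twist q i g) w = wt q i w * conv ?fia g w"
      unfolding twist_conv[symmetric] by (simp add: twist_def)
    have "skew_der q i (conv f g) (a # w) = wt q i (a # w) * conv f g (i # a # w)
        + f [] * skew_der q i (\<lambda>u. g (a # u)) w + skew_der q i (conv ?fa g) w"
      unfolding skew_der.simps(2) 1 skew_der_add skew_der_scale
      by (simp only: scale_def plus_fun_apply add.assoc)
    also note Cons
    finally have lhs: "skew_der q i (conv f g) (a # w) = wt q i (a # w) * conv f g (i # a # w)
        + f [] * skew_der q i (\<lambda>u. g (a # u)) w
        + (conv ?fa (skew_der q i g) + conv (skew_der q i ?fa) (twist q i g)) w" .
    have "conv (skew_der q i f) (twist q i g) (a # w) = f [i] * twist q i g (a # w)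
        + q i a * (wt q i w * conv ?fia g w) + conv (skew_der q i ?fa) (twist q i g) w"
      unfolding conv.simps 2 conv_add_left conv_scale_left
      by (simp only: plus_fun_apply scale_def 3 skew_der.simps add.assoc)
    then show ?case unfolding lhs
      by (simp only: plus_fun_apply) (simp add: twist_def algebra_simps)
  qed
qed

text \<open>Here \<open>j\<close> counts the letters in front of the removed one. In this form the
  skew derivation will be matched with the sum of braid chains in the quantum symmetrizer.\<close>

lemma skew_der_eq_sum:
  "skew_der q i f w = (\<Sum>j\<le>length w. wt q i (drop j w) * f (take j w @ i # drop j w))"
proof (induction w arbitrary: f)
  case (Cons a w)
  show ?case
    unfolding length_Cons sum.atMost_Suc_shift by (simp add: Cons)
qed simp

lemma skew_ders_linear:
  "skew_ders q ks (f + g) = skew_ders q ks f + skew_ders q ks g"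
  "skew_ders q ks (scale c f) = scale c (skew_ders q ks f)"
  by (induction ks arbitrary: f g) (auto simp: skew_der_add)

lemma skew_ders_zero [simp]: "skew_ders q ks 0 = 0"
  using skew_ders_linear(2)[of q ks 0 0] by simp

lemma skew_ders_append: "skew_ders q (ks @ js) f = skew_ders q js (skew_ders q ks f)"
  by (induction ks arbitrary: f) auto

section \<open>Powers of a homogeneous element under skew derivations\<close>

context
  fixes q :: "nat \<Rightarrow> nat \<Rightarrow> complex" and z :: wpoly and \<chi> :: "nat \<Rightarrow> complex"
    and i\<^sub>0 :: nat and ks :: "nat list" and c :: complex
  assumes homogeneous: "\<And>i. twist q i z = scale (\<chi> i) z"
    and vanish: "\<And>i. i \<in> set ks \<Longrightarrow> skew_der q i z = 0"
    and value_z: "skew_ders q (i\<^sub>0 # ks) z = scale c unit_poly"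
    and \<chi>_one: "\<chi> i\<^sub>0 * (\<Prod>i\<leftarrow>ks. \<chi> i) = 1"
begin

lemma twist_conv_power: "twist q i (conv_power z k) = scale (\<chi> i ^ k) (conv_power z k)"
  by (induction k) (simp_all add: twist_conv homogeneous mult.commute)

lemma skew_der_conv_power_zero: "i \<in> set ks \<Longrightarrow> skew_der q i (conv_power z k) = 0"
  by (induction k) (simp_all add: skew_der_conv vanish)

lemma skew_ders_conv_left:
  "set js \<subseteq> set ks \<Longrightarrow> skew_ders q js (conv z f) = conv z (skew_ders q js f)"
  by (induction js arbitrary: f) (simp_all add: skew_der_conv vanish)

lemma skew_ders_conv_right:
  "set js \<subseteq> set ks \<Longrightarrow> skew_ders q js (conv y (conv_power z k))
    = scale ((\<Prod>i\<leftarrow>js. \<chi> i) ^ k) (conv (skew_ders q js y) (conv_power z k))"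
  by (induction js arbitrary: y)
    (simp_all add: skew_der_conv skew_der_conv_power_zero twist_conv_power skew_ders_linear
      power_mult_distrib)

text \<open>In a product of \<open>z\<close> and a power of \<open>z\<close>, the derivation by
  \<open>i\<^sub>0\<close> hits one of the two factors. The derivations in \<open>ks\<close> kill
  \<open>z\<close> and its powers, so they act only on the part already differentiated. Passing the
  power costs a power of the scalar in \<open>\<chi>_one\<close>, which is 1; hence the ordinary
  integer \<open>k\<close> appears and not a q-integer. For \<open>k = 0\<close> the truncated
  exponent is harmless since the scalar is 0.\<close>

lemma skew_ders_conv_power:
  "skew_ders q (i\<^sub>0 # ks) (conv_power z k) = scale (c * of_nat k) (conv_power z (k - 1))"
proof (induction k)
  case (Suc k)
  have "skew_ders q (i\<^sub>0 # ks) (conv_power z (Suc k))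
     = conv z (skew_ders q (i\<^sub>0 # ks) (conv_power z k))
       + scale ((\<chi> i\<^sub>0 * (\<Prod>i\<leftarrow>ks. \<chi> i)) ^ k)
           (conv (skew_ders q (i\<^sub>0 # ks) z) (conv_power z k))"
    by (simp add: skew_der_conv skew_ders_linear skew_ders_conv_left skew_ders_conv_right
        twist_conv_power power_mult_distrib)
  also have "\<dots> = conv z (scale (c * of_nat k) (conv_power z (k - 1))) + scale c (conv_power z k)"
    by (simp only: Suc value_z \<chi>_one) simp
  also have "\<dots> = scale (c * of_nat (Suc k)) (conv_power z k)"
    by (cases k) (simp_all add: algebra_simps, auto simp: scale_def algebra_simps)
  finally show ?case by simp
qed simp

text \<open>Repeating the word \<open>k\<close> times strips off all factors and leaves the constant
  \<open>c ^ k * fact k\<close>, which is nonzero in characteristic 0.\<close>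

lemma skew_ders_conv_power_nonzero:
  assumes "c \<noteq> 0"
  shows "\<exists>js. length js = k * Suc (length ks) \<and> set js \<subseteq> insert i\<^sub>0 (set ks)
    \<and> skew_ders q js (conv_power z k) [] \<noteq> 0"
proof (induction k)
  case (Suc k)
  then obtain js where js: "length js = k * Suc (length ks)" "set js \<subseteq> insert i\<^sub>0 (set ks)"
    "skew_ders q js (conv_power z k) [] \<noteq> 0" by blast
  have "skew_ders q ((i\<^sub>0 # ks) @ js) (conv_power z (Suc k)) [] \<noteq> 0"
    using js(3) assms unfolding skew_ders_append skew_ders_conv_power skew_ders_linear
    by (simp add: scale_def del: of_nat_Suc)
  with js(1,2) show ?case by (intro exI[of _ "(i\<^sub>0 # ks) @ js"]) auto
qed (simp add: unit_poly_def)

end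

section \<open>The quantum symmetrizer on a diagonal braided subspace\<close>

lemma tapply_cong:
  "(\<And>w. w \<in> S \<Longrightarrow> F w = G w) \<Longrightarrow> tapply S A F = tapply S A G"
  unfolding tapply_def by (intro ext if_cong refl sum.cong) auto

lemma tapply_tmult: "tapply S (tmult S A B) F = tapply S A (tapply S B F)"
proof
  fix w
  have "(\<Sum>w'\<in>S. (\<Sum>v\<in>S. A w v * B v w') * F w') = (\<Sum>v\<in>S. \<Sum>w'\<in>S. A w v * (B v w' * F w'))"
    unfolding sum_distrib_right mult.assoc by (rule sum.swap)
  also have "\<dots> = (\<Sum>v\<in>S. A w v * (\<Sum>w'\<in>S. B v w' * F w'))"
    by (simp add: sum_distrib_left)
  finally show "tapply S (tmult S A B) F w = tapply S A (tapply S B F) w"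
    by (simp add: tapply_def tmult_def)
qed

lemma tapply_sum: "tapply S (\<lambda>w w'. \<Sum>k\<in>K. A k w w') F w = (\<Sum>k\<in>K. tapply S (A k) F w)"
proof (cases "w \<in> S")
  case True
  then show ?thesis unfolding tapply_def
    by (simp add: sum_distrib_right) (rule sum.swap)
qed (simp add: tapply_def)

lemma Wd_Suc: "Wd C d (Suc m) = (\<lambda>(w, b). w @ [b]) ` (Wd C d m \<times> Bas C d)"
proof (intro equalityI subsetI)
  fix w assume w: "w \<in> Wd C d (Suc m)"
  then have "w \<noteq> []" by (auto simp: Wd_def)
  then have "w = butlast w @ [last w]" by simp
  moreover have "butlast w \<in> Wd C d m" "last w \<in> Bas C d"
    using w \<open>w \<noteq> []\<close> by (auto simp: Wd_def dest: in_set_butlastD)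
  ultimately show "w \<in> (\<lambda>(w, b). w @ [b]) ` (Wd C d m \<times> Bas C d)"
    by (intro image_eqI[of _ _ "(butlast w, last w)"]) auto
qed (auto simp: Wd_def)

lemma finite_Wd: "finite C \<Longrightarrow> finite (Wd C d m)"
  using finite_lists_length_eq[of "Bas C d" m] by (simp add: Wd_def Bas_def conj_commute)

lemma tapply_ext_id:
  assumes fin: "finite C" and w: "w \<in> Wd C d m" and b: "b \<in> Bas C d"
  shows "tapply (Wd C d (Suc m)) (ext_id A) G (w @ [b])
    = tapply (Wd C d m) A (\<lambda>u. G (u @ [b])) w"
proof -
  have inj: "inj_on (\<lambda>(w, b). w @ [b]) (Wd C d m \<times> Bas C d)"
    by (auto simp: inj_on_def)
  have "(\<Sum>w'\<in>Wd C d (Suc m). ext_id A (w @ [b]) w' * G w')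
      = (\<Sum>u\<in>Wd C d m. \<Sum>b'\<in>Bas C d. if b = b' then A w u * G (u @ [b']) else 0)"
    unfolding Wd_Suc sum.reindex[OF inj] sum.cartesian_product
    by (intro sum.cong) (auto simp: ext_id_def)
  also have "\<dots> = (\<Sum>u\<in>Wd C d m. A w u * G (u @ [b]))"
    using fin b by (simp add: sum.delta Bas_def)
  finally show ?thesis using w b by (auto simp: tapply_def Wd_Suc)
qed

lemma split_list_at_two:
  "i + 1 < length w \<Longrightarrow> w = take i w @ w ! i # w ! (i + 1) # drop (i + 2) w"
  by (simp add: Cons_nth_drop_Suc)

text \<open>Let \<open>x i\<close> be the vector \<open>v i\<close> placed in the component of
  \<open>t i\<close>. As the degrees commute, \<open>t i\<close> preserves the component of
  \<open>t j\<close>, and by \<open>diagonal\<close> the vector \<open>v j\<close> is an eigenvector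
  there. So the braiding sends the tensor of \<open>x i\<close> and \<open>x j\<close> to
  \<open>q i j\<close> times that of \<open>x j\<close> and \<open>x i\<close>.\<close>

locale diagonal_family =
  fixes C :: "perm set" and d :: nat and g :: "perm \<Rightarrow> perm"
    and \<rho> :: "perm \<Rightarrow> nat \<Rightarrow> nat \<Rightarrow> complex"
    and I :: "nat set" and t :: "nat \<Rightarrow> perm" and v :: "nat \<Rightarrow> nat \<Rightarrow> complex"
    and q :: "nat \<Rightarrow> nat \<Rightarrow> complex"
  assumes finite_C: "finite C"
    and t_in_C: "i \<in> I \<Longrightarrow> t i \<in> C"
    and inj_t: "inj_on t I"
    and t_commute: "i \<in> I \<Longrightarrow> j \<in> I \<Longrightarrow> t i \<circ> t j \<circ> inv (t i) = t j"
    and surj_t: "i \<in> I \<Longrightarrow> bij (t i)"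
    and v_nonzero: "i \<in> I \<Longrightarrow> \<exists>k<d. v i k \<noteq> 0"
    and diagonal: "i \<in> I \<Longrightarrow> j \<in> I \<Longrightarrow> a < d \<Longrightarrow>
      (\<Sum>b<d. \<rho> (inv (g (t j)) \<circ> t i \<circ> g (t j)) a b * v j b) = q i j * v j a"
begin

definition index :: "bas \<Rightarrow> nat" where
  "index b = inv_into I t (fst b)"

definition coord :: "bas \<Rightarrow> complex" where
  "coord b = (if fst b \<in> t ` I then v (index b) (snd b) else 0)"

text \<open>Coordinates of the image of \<open>f\<close> in all tensor powers at once, letter
  \<open>i\<close> being sent to \<open>v i\<close> in the component of \<open>t i\<close>. Outside
  these components \<open>index\<close> is arbitrary, but \<open>coord\<close> is 0.\<close>

definition tensor :: "wpoly \<Rightarrow> bas list \<Rightarrow> complex" where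
  "tensor f w = f (map index w) * (\<Prod>b\<leftarrow>w. coord b)"

lemma index_t [simp]: "i \<in> I \<Longrightarrow> index (t i, k) = i"
  by (simp add: index_def inj_t)

lemma coord_t [simp]: "i \<in> I \<Longrightarrow> coord (t i, k) = v i k"
  by (auto simp: coord_def)

text \<open>The braiding transported to words: the coefficient at \<open>J\<close> comes from the
  word with the two letters exchanged, so the indices of the scalar appear in reversed
  order.\<close>

definition swap_at :: "nat \<Rightarrow> wpoly \<Rightarrow> wpoly" where
  "swap_at i f J = q (J ! (i + 1)) (J ! i)
     * f (take i J @ [J ! (i + 1), J ! i] @ drop (i + 2) J)"

text \<open>If \<open>y\<close> lies over \<open>t j\<close>, conjugation by \<open>t j\<close>
  fixes every \<open>t l\<close>. Hence only those \<open>b\<close> in the same component as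
  \<open>x\<close> contribute, and \<open>diagonal\<close> evaluates their sum. If \<open>x\<close>
  lies over none of the \<open>t l\<close>, or \<open>coord y\<close> is 0, both sides
  vanish.\<close>

lemma sum_braid_coord:
  assumes y: "y \<in> Bas C d" and x: "x \<in> Bas C d"
  shows "(\<Sum>b\<in>Bas C d. (if fst x = fst y \<circ> fst b \<circ> inv (fst y)
        then \<rho> (inv (g (fst x)) \<circ> fst y \<circ> g (fst b)) (snd x) (snd b) else 0)
        * (h (index b) * coord y * coord b))
      = q (index y) (index x) * h (index x) * coord y * coord x"
proof (cases "coord y = 0")
  case False
  then obtain j where j: "j \<in> I" "fst y = t j" by (auto simp: coord_def split: if_splits)
  have conj: "t j \<circ> u \<circ> inv (t j) = t l \<longleftrightarrow> u = t l" if "l \<in> I" for u l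
  proof
    assume *: "t j \<circ> u \<circ> inv (t j) = t l"
    have "u = inv (t j) \<circ> (t j \<circ> u \<circ> inv (t j)) \<circ> t j"
      using surj_t[OF j(1)] by (simp add: fun_eq_iff bij_is_inj)
    also have "\<dots> = inv (t j) \<circ> (t j \<circ> t l \<circ> inv (t j)) \<circ> t j"
      unfolding * t_commute[OF j(1) that] ..
    also have "\<dots> = t l"
      using surj_t[OF j(1)] by (simp add: fun_eq_iff bij_is_inj)
    finally show "u = t l" .
  qed (use t_commute[OF j(1) that] in simp)
  let ?s = "\<lambda>b. (if fst x = fst y \<circ> fst b \<circ> inv (fst y)
        then \<rho> (inv (g (fst x)) \<circ> fst y \<circ> g (fst b)) (snd x) (snd b) else 0)
        * (h (index b) * coord y * coord b)"
  show ?thesis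
  proof (cases "fst x \<in> t ` I")
    case True
    then obtain l where l: "l \<in> I" "fst x = t l" by auto
    obtain k where x_eq: "x = (t l, k)" using l by (cases x) auto
    obtain e where y_eq: "y = (t j, e)" using j by (cases y) auto
    have k: "k < d" using x x_eq by (auto simp: Bas_def)
    have "sum ?s (Bas C d) = sum ?s ({t l} \<times> {..<d})"
    proof (rule sum.mono_neutral_right)
      show "\<forall>b\<in>Bas C d - {t l} \<times> {..<d}. ?s b = 0"
      proof
        fix b assume "b \<in> Bas C d - {t l} \<times> {..<d}"
        then have "fst b \<noteq> t l" by (cases b) (auto simp: Bas_def)
        then have "fst x \<noteq> fst y \<circ> fst b \<circ> inv (fst y)"
          unfolding j(2) l(2) using conj[OF l(1), of "fst b"] by metis
        then show "?s b = 0" by simp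
      qed
    qed (use finite_C t_in_C[OF l(1)] in \<open>auto simp: Bas_def\<close>)
    also have "\<dots> = (\<Sum>b<d. ?s (t l, b))"
    proof -
      have "{t l} \<times> {..<d} = Pair (t l) ` {..<d}" by auto
      then show ?thesis
        by (simp only:) (subst sum.reindex, auto simp: inj_on_def)
    qed
    also have "\<dots> = (\<Sum>b<d. h l * v j e * (\<rho> (inv (g (t l)) \<circ> t j \<circ> g (t l)) k b * v l b))"
      using t_commute[OF j(1) l(1)] l(1) j(1) by (intro sum.cong) (simp_all add: x_eq y_eq)
    also have "\<dots> = h l * v j e * (q j l * v l k)"
      unfolding sum_distrib_left[symmetric] diagonal[OF j(1) l(1) k] ..
    finally show ?thesis using l j by (simp add: x_eq y_eq)
  next
    case False
    have "?s b = 0" for b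
    proof (cases "fst b \<in> t ` I")
      case True
      then obtain l where "l \<in> I" "fst b = t l" by auto
      then have "fst x \<noteq> fst y \<circ> fst b \<circ> inv (fst y)"
        using t_commute[OF j(1), of l] j(2) False by auto
      then show ?thesis by simp
    qed (simp add: coord_def)
    then have "sum ?s (Bas C d) = 0" by (intro sum.neutral) blast
    moreover have "coord x = 0" using False by (simp add: coord_def)
    ultimately show ?thesis by simp
  qed
qed simp

lemma tapply_braid_mat:
  assumes i: "i + 1 < m" and w: "w \<in> Wd C d m"
  shows "tapply (Wd C d m) (braid_mat g \<rho> i) (tensor f) w = tensor (swap_at i f) w"
proof -
  have len: "length w = m" using w by (simp add: Wd_def)
  define p where "p = take i w"
  define x where "x = w ! i"
  define y where "y = w ! (i + 1)"
  define s where "s = drop (i + 2) w"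
  have w_eq: "w = p @ x # y # s"
    using i len unfolding p_def x_def y_def s_def
    by (intro split_list_at_two) simp
  have len_p: "length p = i" using i len by (simp add: p_def)
  have inB: "x \<in> Bas C d" "y \<in> Bas C d" "set p \<subseteq> Bas C d" "set s \<subseteq> Bas C d"
    using w by (auto simp: Wd_def w_eq)
  have in_W: "p @ y # b # s \<in> Wd C d m \<longleftrightarrow> b \<in> Bas C d" for b
    using inB len by (auto simp: Wd_def w_eq)
  let ?t = "\<lambda>w'. braid_mat g \<rho> i w w' * tensor f w'"
  \<comment> \<open>In row \<open>w\<close> the matrix is supported on words that agree with
    \<open>w\<close> off the positions \<open>i\<close>, \<open>i + 1\<close> and carry
    \<open>y\<close> at position \<open>i\<close>; only the letter after it is free.\<close>
  have "sum ?t (Wd C d m) = sum ?t ((\<lambda>b. p @ y # b # s) ` Bas C d)"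
  proof (rule sum.mono_neutral_right)
    show "finite (Wd C d m)" by (rule finite_Wd[OF finite_C])
    show "\<forall>w'\<in>Wd C d m - (\<lambda>b. p @ y # b # s) ` Bas C d. ?t w' = 0"
    proof (rule ballI, rule ccontr)
      fix w' assume w': "w' \<in> Wd C d m - (\<lambda>b. p @ y # b # s) ` Bas C d" and "?t w' \<noteq> 0"
      then have eqs: "take i w' = p" "drop (i + 2) w' = s" "w' ! i = y"
        by (auto simp: braid_mat_def Let_def p_def s_def y_def split: if_splits)
      have "length w' = m" using w' by (simp add: Wd_def)
      then have "w' = take i w' @ w' ! i # w' ! (i + 1) # drop (i + 2) w'"
        using i by (intro split_list_at_two) simp
      then have "w' = p @ y # w' ! (i + 1) # s" using eqs by simp
      then show False using w' in_W by (metis DiffE image_eqI)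
    qed
  qed (use in_W in auto)
  also have "\<dots> = (\<Sum>b\<in>Bas C d. ?t (p @ y # b # s))"
    by (subst sum.reindex) (auto simp: inj_on_def)
  also have "\<dots> = (\<Sum>b\<in>Bas C d. (\<Prod>b\<leftarrow>p. coord b) * (\<Prod>b\<leftarrow>s. coord b) *
      ((if fst x = fst y \<circ> fst b \<circ> inv (fst y)
        then \<rho> (inv (g (fst x)) \<circ> fst y \<circ> g (fst b)) (snd x) (snd b) else 0)
        * (f (map index p @ index y # index b # map index s) * coord y * coord b)))"
    by (intro sum.cong)
      (auto simp: braid_mat_def Let_def tensor_def w_eq len_p nth_append)
  also have "\<dots> = (\<Prod>b\<leftarrow>p. coord b) * (\<Prod>b\<leftarrow>s. coord b) *
      (q (index y) (index x) * f (map index p @ index y # index x # map index s)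
        * coord y * coord x)"
    unfolding sum_distrib_left[symmetric]
    by (subst sum_braid_coord[OF inB(2,1), where h = "\<lambda>l. f (map index p @ index y # l # map index s)"]) simp
  also have "\<dots> = tensor (swap_at i f) w"
    by (simp add: tensor_def swap_at_def w_eq len_p nth_append)
  finally show ?thesis using w by (simp add: tapply_def)
qed

text \<open>The chain carries the letter at position \<open>m - k\<close> to the last place, past
  \<open>k\<close> letters. The induction peels off the factor that is applied first and absorbs it
  into \<open>f\<close> as \<open>swap_at\<close>.\<close>

lemma tapply_braid_chain:
  assumes "k \<le> m" and w: "w \<in> Wd C d m" and b: "b \<in> Bas C d"
  shows "tapply (Wd C d (Suc m)) (braid_chain C d g \<rho> m k) (tensor f) (w @ [b])
    = wt q (index b) (drop (m - k) (map index w))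
      * f (take (m - k) (map index w) @ index b # drop (m - k) (map index w))
      * (coord b * (\<Prod>b\<leftarrow>w. coord b))"
  using assms(1)
proof (induction k arbitrary: f)
  case 0
  have wb: "w @ [b] \<in> Wd C d (Suc m)" using w b by (auto simp: Wd_Suc)
  have len: "length w = m" using w by (simp add: Wd_def)
  have "tapply (Wd C d (Suc m)) tid (tensor f) (w @ [b]) =
     (\<Sum>w'\<in>Wd C d (Suc m). if w @ [b] = w' then tensor f w' else 0)"
    using wb by (auto simp: tapply_def tid_def intro!: sum.cong)
  also have "\<dots> = tensor f (w @ [b])"
    using wb finite_Wd[OF finite_C] by (simp add: sum.delta)
  finally show ?case using len by (simp only: braid_chain.simps) (simp add: tensor_def)
next
  case (Suc k)
  let ?W = "Wd C d (Suc m)" and ?J = "map index w"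
  have len: "length w = m" using w by (simp add: Wd_def)
  define p where "p = take (m - Suc k) ?J"
  define x where "x = ?J ! (m - Suc k)"
  define s where "s = drop (m - k) ?J"
  have J: "?J = p @ x # s"
    using Suc.prems len unfolding p_def x_def s_def
    using id_take_nth_drop[of "m - Suc k" ?J] by (simp add: Suc_diff_Suc Suc_le_lessD)
  have len_p: "length p = m - Suc k" using len Suc.prems by (simp add: p_def)
  have mk: "m - k = Suc (m - Suc k)" using Suc.prems by simp
  have "tapply ?W (braid_chain C d g \<rho> m (Suc k)) (tensor f) =
    tapply ?W (braid_chain C d g \<rho> m k) (tensor (swap_at (m - 1 - k) f))"
    unfolding braid_chain.simps tapply_tmult
    by (intro tapply_cong tapply_braid_mat) (use Suc.prems in auto)
  then show ?case using Suc.prems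
    by (simp add: Suc.IH J mk len_p swap_at_def nth_append)
qed

text \<open>Once the last letter \<open>b\<close> is fixed, the sum of braid chains becomes the skew
  derivation by \<open>index b\<close>, while the remaining factor acts on the first
  \<open>m\<close> positions only.\<close>

lemma tapply_quantum_symmetrizer_Suc:
  assumes w: "w \<in> Wd C d m" and b: "b \<in> Bas C d"
  shows "tapply (Wd C d (Suc m)) (quantum_symmetrizer C d g \<rho> (Suc m)) (tensor f) (w @ [b])
    = coord b * tapply (Wd C d m) (quantum_symmetrizer C d g \<rho> m)
        (tensor (skew_der q (index b) f)) w"
proof -
  let ?T = "\<lambda>w w'. \<Sum>k\<le>m. braid_chain C d g \<rho> m k w w'"
  have T: "tapply (Wd C d (Suc m)) ?T (tensor f) (u @ [b])
      = coord b * tensor (skew_der q (index b) f) u" if u: "u \<in> Wd C d m" for u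
  proof -
    have len: "length u = m" using u by (simp add: Wd_def)
    let ?h = "\<lambda>j. wt q (index b) (drop j (map index u))
      * f (take j (map index u) @ index b # drop j (map index u))"
    \<comment> \<open>A chain of \<open>k\<close> braidings leaves \<open>m - k\<close> letters in
      front, so the summation order is reversed.\<close>
    have "(\<Sum>k\<le>m. ?h (m - k)) = (\<Sum>k\<le>m. ?h k)"
      using sum.nat_diff_reindex[of ?h "Suc m"] by (simp add: lessThan_Suc_atMost)
    then have "(\<Sum>k\<le>m. ?h (m - k)) = skew_der q (index b) f (map index u)"
      by (simp add: skew_der_eq_sum len)
    moreover have "tapply (Wd C d (Suc m)) ?T (tensor f) (u @ [b])
      = (\<Sum>k\<le>m. ?h (m - k)) * (coord b * (\<Prod>b\<leftarrow>u. coord b))"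
      unfolding tapply_sum sum_distrib_right
      by (intro sum.cong refl tapply_braid_chain[OF _ u b]) auto
    ultimately show ?thesis by (simp add: tensor_def)
  qed
  have "tapply (Wd C d (Suc m)) (quantum_symmetrizer C d g \<rho> (Suc m)) (tensor f) (w @ [b])
    = tapply (Wd C d m) (quantum_symmetrizer C d g \<rho> m)
        (\<lambda>u. tapply (Wd C d (Suc m)) ?T (tensor f) (u @ [b])) w"
    by (simp only: quantum_symmetrizer.simps tapply_tmult tapply_ext_id[OF finite_C w b])
  also have "\<dots> = tapply (Wd C d m) (quantum_symmetrizer C d g \<rho> m)
        (\<lambda>u. coord b * tensor (skew_der q (index b) f) u) w"
    by (subst tapply_cong[OF T]) auto
  also have "\<dots> = coord b * tapply (Wd C d m) (quantum_symmetrizer C d g \<rho> m)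
        (tensor (skew_der q (index b) f)) w"
    by (simp add: tapply_def sum_distrib_left mult.left_commute)
  finally show ?thesis .
qed

text \<open>Each derivation strips off the last tensor position, so \<open>js\<close> lists the
  degrees of the witness \<open>w\<close> from right to left. At each position a nonvanishing
  coordinate of \<open>v i\<close> is selected.\<close>

lemma tapply_quantum_symmetrizer_nonzero:
  assumes "set js \<subseteq> I" and "skew_ders q js f [] \<noteq> 0"
  shows "\<exists>w\<in>Wd C d (length js).
    tapply (Wd C d (length js)) (quantum_symmetrizer C d g \<rho> (length js)) (tensor f) w \<noteq> 0"
  using assms
proof (induction js arbitrary: f)
  case Nil
  then show ?case by (simp add: Wd_def tapply_def tid_def tensor_def)
next
  case (Cons i js)
  then have i: "i \<in> I" by simp
  obtain k where k: "k < d" "v i k \<noteq> 0" using v_nonzero[OF i] by blast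
  have b: "(t i, k) \<in> Bas C d" using k t_in_C[OF i] by (simp add: Bas_def)
  from Cons obtain w where w: "w \<in> Wd C d (length js)"
    "tapply (Wd C d (length js)) (quantum_symmetrizer C d g \<rho> (length js))
      (tensor (skew_der q i f)) w \<noteq> 0"
    by fastforce
  then have "tapply (Wd C d (Suc (length js))) (quantum_symmetrizer C d g \<rho> (Suc (length js)))
      (tensor f) (w @ [(t i, k)]) \<noteq> 0"
    using tapply_quantum_symmetrizer_Suc[OF w(1) b, of f] i k by simp
  moreover have "w @ [(t i, k)] \<in> Wd C d (Suc (length js))"
    using w(1) b by (auto simp: Wd_Suc)
  ultimately show ?case by (auto simp del: quantum_symmetrizer.simps)
qed

end

section \<open>From nonzero quantum symmetrizers to infinite dimension\<close>

lemma sum_fun_apply: "(\<Sum>a\<in>A. F a) x = (\<Sum>a\<in>A. F a x)"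
  for F :: "'a \<Rightarrow> 'b \<Rightarrow> 'c::comm_monoid_add"
  by (induction A rule: infinite_finite_induct) auto

text \<open>An infinite basis would have \<open>card\<close> 0. The range is therefore first placed
  in the span of finitely many coordinate vectors, after which a nonzero element forces a nonempty
  finite basis.\<close>

lemma nichols_component_dim_pos:
  assumes "finite C" and "w \<in> Wd C d m"
    and "tapply (Wd C d m) (quantum_symmetrizer C d g \<rho> m) F w \<noteq> 0"
  shows "nichols_component_dim C d g \<rho> m > 0"
proof -
  interpret vs: vector_space "\<lambda>(c::complex) (f :: bas list \<Rightarrow> complex) x. c * f x"
    by unfold_locales (auto simp: algebra_simps fun_eq_iff)
  let ?W = "Wd C d m"
  let ?R = "range (tapply ?W (quantum_symmetrizer C d g \<rho> m))"
  define e where "e = (\<lambda>(u :: bas list) x. if x = u then 1 else (0::complex))"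
  have fin: "finite ?W" using assms(1) by (rule finite_Wd)
  have "?R \<subseteq> vs.span (e ` ?W)"
  proof (clarify)
    fix F
    let ?G = "tapply ?W (quantum_symmetrizer C d g \<rho> m) F"
    have eq: "?G = (\<Sum>u\<in>?W. (\<lambda>x. ?G u * e u x))"
    proof
      fix x
      have "(\<Sum>u\<in>?W. (\<lambda>x. ?G u * e u x)) x = (\<Sum>u\<in>?W. ?G u * e u x)"
        by (rule sum_fun_apply)
      also have "\<dots> = (\<Sum>u\<in>?W. if x = u then ?G u else 0)"
        by (intro sum.cong) (auto simp: e_def)
      also have "\<dots> = ?G x" using fin by (simp add: sum.delta tapply_def)
      finally show "?G x = (\<Sum>u\<in>?W. (\<lambda>x. ?G u * e u x)) x" ..
    qed
    have "(\<lambda>x. ?G u * e u x) \<in> vs.span (e ` ?W)" if "u \<in> ?W" for u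
      using that vs.span_scale[of "e u" "e ` ?W" "?G u"] vs.span_base[of "e u" "e ` ?W"] by simp
    then have "(\<Sum>u\<in>?W. (\<lambda>x. ?G u * e u x)) \<in> vs.span (e ` ?W)"
      by (rule vs.span_sum)
    then show "?G \<in> vs.span (e ` ?W)" by (simp only: eq[symmetric])
  qed
  moreover obtain B where B: "B \<subseteq> ?R" "vs.independent B" "?R \<subseteq> vs.span B" "card B = vs.dim ?R"
    by (rule vs.basis_exists)
  ultimately have "finite B"
    using vs.independent_span_bound[of "e ` ?W" B] fin by blast
  moreover have "B \<noteq> {}"
  proof
    assume "B = {}"
    then have "tapply ?W (quantum_symmetrizer C d g \<rho> m) F = 0" using B(3) by auto
    then show False using assms(3) by simp
  qed
  ultimately show ?thesis
    using B(4) card_gt_0_iff[of B] by (simp add: nichols_component_dim_def)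
qed

lemma nichols_dim_infinite:
  assumes "0 < l" and "\<And>k. nichols_component_dim C d g \<rho> (k * l) > 0"
  shows "nichols_dim C d g \<rho> = \<infinity>"
proof -
  let ?f = "nichols_component_dim C d g \<rho>"
  have "enat K \<le> nichols_dim C d g \<rho>" for K
  proof -
    have inj: "inj_on (\<lambda>k. k * l) {..<K}" using assms(1) by (auto simp: inj_on_def)
    have "K = (\<Sum>k<K. 1)" by simp
    also have "\<dots> \<le> (\<Sum>k<K. ?f (k * l))"
      using assms(2) by (intro sum_mono) (simp add: Suc_leI)
    also have "\<dots> = sum ?f ((\<lambda>k. k * l) ` {..<K})"
      using inj by (simp add: sum.reindex)
    also have "\<dots> \<le> sum ?f {..<K * l}"
      using assms(1) by (intro sum_mono2) auto
    finally have "enat K \<le> enat (sum ?f {..<K * l})" by simp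
    also have "\<dots> \<le> nichols_dim C d g \<rho>"
      unfolding nichols_dim_def by (rule SUP_upper) simp
    finally show ?thesis .
  qed
  then show ?thesis
    by (cases "nichols_dim C d g \<rho>") (auto, metis Suc_n_not_le_n enat_ord_simps(1))
qed

lemma (in diagonal_family) nichols_dim_infinite_if_conv_power:
  assumes "0 < l"
    and "\<And>k. \<exists>js. length js = k * l \<and> set js \<subseteq> I \<and> skew_ders q js (conv_power z k) [] \<noteq> 0"
  shows "nichols_dim C d g \<rho> = \<infinity>"
proof (rule nichols_dim_infinite[OF assms(1)])
  fix k
  obtain js where js: "length js = k * l" "set js \<subseteq> I" "skew_ders q js (conv_power z k) [] \<noteq> 0"
    using assms(2) by blast
  show "nichols_component_dim C d g \<rho> (k * l) > 0"
    using tapply_quantum_symmetrizer_nonzero[OF js(2,3)] nichols_component_dim_pos[OF finite_C]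
    unfolding js(1) by blast
qed

section \<open>Powers of brackets\<close>

definition bracket :: "complex \<Rightarrow> wpoly \<Rightarrow> wpoly \<Rightarrow> wpoly" where
  "bracket c f h = conv f h + scale (- c) (conv h f)"

lemma scale_add_distrib: "scale c (f + h) = scale c f + scale c h"
  by (auto simp: scale_def algebra_simps)

lemma scale_add_collect [simp]:
  "scale a f + scale b f = scale (a + b) f"
  "f + scale b f = scale (1 + b) f" "scale a f + f = scale (a + 1) f"
  "numeral m * f = scale (numeral m) f"
  by (auto simp: scale_def algebra_simps)

lemma twist_bracket:
  assumes "twist q i f = scale a f" "twist q i h = scale b h"
  shows "twist q i (bracket c f h) = scale (a * b) (bracket c f h)"
  by (simp add: bracket_def twist_add twist_conv assms scale_add_distrib mult.commute)

text \<open>Since \<open>f\<close> is not differentiated, the only effect besides differentiating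
  \<open>h\<close> is the scalar \<open>a\<close> picked up when \<open>f\<close> stands on the
  right.\<close>

lemma skew_der_bracket_right:
  assumes "twist q i f = scale a f" "skew_der q i f = 0"
  shows "skew_der q i (bracket c f h) = bracket (c * a) f (skew_der q i h)"
  by (simp add: bracket_def skew_der_add skew_der_conv assms)

text \<open>The two surviving terms are the twist of \<open>h\<close> and \<open>c\<close> times
  \<open>h\<close>. They cancel exactly when \<open>c\<close> is the braiding scalar of the letter
  with \<open>h\<close>.\<close>

lemma skew_der_bracket_zero:
  assumes "skew_der q i f = unit_poly" "skew_der q i h = 0" "twist q i h = scale c h"
  shows "skew_der q i (bracket c f h) = 0"
  by (simp add: bracket_def skew_der_add skew_der_conv assms)

context diagonal_family
begin

lemma nichols_dim_infinite_one_letter: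
  assumes "I = {i}" and "q i i = 1"
  shows "nichols_dim C d g \<rho> = \<infinity>"
proof (rule nichols_dim_infinite_if_conv_power[of 1 "letter i"])
  fix k
  show "\<exists>js. length js = k * 1 \<and> set js \<subseteq> I \<and> skew_ders q js (conv_power (letter i) k) [] \<noteq> 0"
    using skew_ders_conv_power_nonzero[of q "letter i" "\<lambda>j. q j i" "[]" i 1 k] assms by simp
qed simp

text \<open>The derivation by \<open>i\<close> kills the bracket, and the one by \<open>j\<close>
  leaves \<open>1 - q i j * q j i\<close> times the letter \<open>i\<close>. The product of the four
  scalars is the self-braiding of the degree of the bracket.\<close>

lemma nichols_dim_infinite_two_letters:
  assumes I: "I = {i, j}" "i \<noteq> j"
    and "q i i * q i j * q j i * q j j = 1" and "q i j * q j i \<noteq> 1"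
  shows "nichols_dim C d g \<rho> = \<infinity>"
proof (rule nichols_dim_infinite_if_conv_power[of 2 "bracket (q i j) (letter i) (letter j)"])
  fix k
  let ?z = "bracket (q i j) (letter i) (letter j)"
  have "skew_ders q [j, i] ?z = scale (1 - q i j * q j i) unit_poly"
    using I(2) by (simp add: skew_der_bracket_right) (simp add: bracket_def)
  then show "\<exists>js. length js = k * 2 \<and> set js \<subseteq> I \<and> skew_ders q js (conv_power ?z k) [] \<noteq> 0"
    using skew_ders_conv_power_nonzero[of q ?z "\<lambda>l. q l i * q l j" "[i]" j "1 - q i j * q j i" k]
      assms by (simp add: twist_bracket skew_der_bracket_zero insert_commute mult_2_right mult.assoc algebra_simps)
qed simp

text \<open>The pairs with \<open>q i j * q j i = -1\<close> are the edges of the 4-cycle 0--1--2--3--0.\<close>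

lemma nichols_dim_infinite_four_letters:
  assumes I: "I = {0, 1, 2, 3}"
    and q: "\<And>i j. i \<in> I \<Longrightarrow> j \<in> I \<Longrightarrow> q i j = (if odd i \<and> even j then 1 else -1)"
  shows "nichols_dim C d g \<rho> = \<infinity>"
proof (rule nichols_dim_infinite_if_conv_power)
  fix k
  \<comment> \<open>Each bracket constant is the braiding of the new letter with the inner element:
    \<open>q 2 1 = -1\<close>, then \<open>q 0 2 * q 0 1 = 1\<close>, then
    \<open>q 3 0 * q 3 2 * q 3 1 = -1\<close>. So the derivations by 2, 0 and 3 kill
    \<open>z\<close>, and only the one by 1 survives.\<close>
  define x :: wpoly where "x = bracket (-1) (letter 2) (letter 1)"
  define y where "y = bracket 1 (letter 0) x"
  define z where "z = bracket (-1) (letter 3) y"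
  have q_simps: "q 0 0 = -1" "q 0 1 = -1" "q 0 2 = -1" "q 0 3 = -1"
    "q 1 0 = 1" "q 1 1 = -1" "q 1 2 = 1" "q 1 3 = -1"
    "q 2 0 = -1" "q 2 1 = -1" "q 2 2 = -1" "q 2 3 = -1"
    "q 3 0 = 1" "q 3 1 = -1" "q 3 2 = 1" "q 3 3 = -1"
    using q by (auto simp: I)
  have tx: "twist q i x = scale (q i 2 * q i 1) x" for i
    unfolding x_def by (rule twist_bracket) simp_all
  have ty: "twist q i y = scale (q i 0 * (q i 2 * q i 1)) y" for i
    unfolding y_def by (rule twist_bracket) (simp_all add: tx)
  have tz: "twist q i z = scale (q i 3 * (q i 0 * (q i 2 * q i 1))) z" for i
    unfolding z_def by (rule twist_bracket) (simp_all add: ty)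
  have dx: "skew_der q 0 x = 0" "skew_der q 1 x = scale 2 (letter 2)"
    "skew_der q 2 x = 0" "skew_der q 3 x = 0"
    by (simp_all add: x_def bracket_def skew_der_add skew_der_conv q_simps del: One_nat_def)
  have dy: "skew_der q 0 y = 0" "skew_der q 2 y = 0" "skew_der q 3 y = 0"
    "skew_der q 1 y = scale 2 (bracket 1 (letter 0) (letter 2))"
    by (simp_all add: y_def bracket_def skew_der_add skew_der_conv q_simps tx dx scale_add_distrib del: One_nat_def)
  have dz: "skew_der q 0 z = 0" "skew_der q 2 z = 0" "skew_der q 3 z = 0"
    "skew_der q 1 z = scale 2 (bracket 1 (letter 3) (bracket 1 (letter 0) (letter 2)))"
    by (simp_all add: z_def bracket_def skew_der_add skew_der_conv q_simps ty dy scale_add_distrib conv_add_left conv_add_right del: One_nat_def)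
  have "skew_der q 2 (bracket 1 (letter 3) (bracket 1 (letter 0) (letter 2)))
      = scale 2 (conv (letter 3) (letter 0) + conv (letter 0) (letter 3))"
    by (simp add: bracket_def skew_der_add skew_der_conv conv_add_left conv_add_right
        twist_add twist_conv q_simps scale_add_distrib del: One_nat_def)
  \<comment> \<open>The derivations by 1, 2 and 3 contribute a factor 2 each, the last one a factor
    1.\<close>
  then have "skew_ders q [1, 2, 3, 0] z = scale 8 unit_poly"
    by (simp add: dz(4) skew_ders_linear skew_der_add skew_der_conv q_simps conv_add_left del: One_nat_def)
  moreover have "skew_der q i z = 0" if "i \<in> set [2, 3, 0]" for i
    using that dz by auto
  \<comment> \<open>Every letter occurs once in the degree of \<open>z\<close>. Of the sixteen
    scalars \<open>q i j\<close> twelve are -1 and four are 1, so the self-braiding is 1.\<close>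
  ultimately obtain js where "length js = k * Suc (length [2, 3, 0 :: nat])"
    "set js \<subseteq> insert 1 (set [2, 3, 0])" "skew_ders q js (conv_power z k) [] \<noteq> 0"
    using skew_ders_conv_power_nonzero[of q z, OF tz, where i\<^sub>0 = 1 and ks = "[2, 3, 0]" and c = 8 and k = k]
    by (auto simp: q_simps simp del: One_nat_def)
  then show "\<exists>js. length js = k * 4 \<and> set js \<subseteq> I \<and> skew_ders q js (conv_power z k) [] \<noteq> 0"
    by (intro exI[of _ js]) (auto simp: I)
qed simp

end

section \<open>Eigenvectors of centralizers\<close>

lemma Sym_id: "id \<in> Sym N"
  by (simp add: Sym_def permutes_id)

lemma Sym_comp: "p \<in> Sym N \<Longrightarrow> p' \<in> Sym N \<Longrightarrow> p \<circ> p' \<in> Sym N"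
  by (simp add: Sym_def permutes_compose)

lemma Sym_inv: "p \<in> Sym N \<Longrightarrow> inv p \<in> Sym N"
  by (simp add: Sym_def permutes_inv)

lemma Sym_inverses:
  assumes "p \<in> Sym N"
  shows "p (inv p x) = x" "inv p (p x) = x"
  using assms by (auto simp: Sym_def permutes_inverses)

lemma Sym_bij: "p \<in> Sym N \<Longrightarrow> bij p"
  by (simp add: Sym_def permutes_bij)

lemma finite_conj_class: "s \<in> Sym N \<Longrightarrow> finite (conj_class N s)"
  by (rule finite_subset[of _ "Sym N"])
    (auto simp: conj_class_def Sym_def intro: permutes_compose permutes_inv finite_permutations)

lemma centralizer_comp:
  assumes "a \<in> centralizer N s" "b \<in> centralizer N s"
  shows "a \<circ> b \<in> centralizer N s"
proof -
  have "a \<circ> b \<circ> s = a \<circ> s \<circ> b" using assms(2) by (simp add: centralizer_def comp_assoc)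
  also have "\<dots> = s \<circ> (a \<circ> b)" using assms(1) by (simp add: centralizer_def comp_assoc)
  finally show ?thesis using assms by (simp add: centralizer_def Sym_comp)
qed

lemma centralizer_inv:
  assumes "a \<in> centralizer N s"
  shows "inv a \<in> centralizer N s"
proof -
  have a: "a \<in> Sym N" "\<And>x. a (s x) = s (a x)"
    using assms by (auto simp: centralizer_def fun_eq_iff)
  have "inv a (s x) = s (inv a x)" for x
    using a(2)[of "inv a x"] by (metis Sym_inverses[OF a(1)])
  then show ?thesis using a(1) by (auto simp: centralizer_def Sym_inv)
qed

lemma dapply_sum:
  "dapply d A (\<lambda>i. \<Sum>j\<in>J. c j * x j i) = (\<lambda>i. \<Sum>j\<in>J. c j * dapply d A (x j) i)"
proof
  fix i
  have "(\<Sum>k<d. A i k * (\<Sum>j\<in>J. c j * x j k)) = (\<Sum>k<d. \<Sum>j\<in>J. c j * (A i k * x j k))"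
    by (simp add: sum_distrib_left mult.left_commute)
  also have "\<dots> = (\<Sum>j\<in>J. c j * (\<Sum>k<d. A i k * x j k))"
    by (subst sum.swap) (simp add: sum_distrib_left)
  finally show "dapply d A (\<lambda>i. \<Sum>j\<in>J. c j * x j i) i = (\<Sum>j\<in>J. c j * dapply d A (x j) i)"
    by (simp add: dapply_def)
qed

lemma sum_powers_root_of_unity:
  fixes z :: complex
  assumes "z ^ L = 1" "z \<noteq> 1"
  shows "(\<Sum>k<L. z ^ k) = 0"
  using assms by (simp add: sum_gp_strict)

text \<open>The discrete Fourier transform of the orbit of \<open>v\<close> consists of eigenvectors and sums to
  a multiple of \<open>v\<close>.\<close>

lemma eigenvector_of_finite_order:
  assumes L: "0 < L" and v: "v \<in> cvec d" "v \<noteq> (\<lambda>_. 0)" and period: "(dapply d A ^^ L) v = v"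
  obtains w c where "w \<in> cvec d" "w \<noteq> (\<lambda>_. 0)" "dapply d A w = (\<lambda>i. c * w i)"
proof -
  let ?T = "dapply d A"
  define \<omega> where "\<omega> = cis (2 * pi / real L)"
  have pow: "\<omega> ^ j = cis (2 * pi * real j / real L)" for j
    by (simp add: \<omega>_def Complex.DeMoivre mult.commute mult.left_commute)
  have \<omega>_L: "\<omega> ^ L = 1" using L by (simp add: pow)
  have \<omega>_neq: "\<omega> ^ j \<noteq> 1" if "0 < j" "j < L" for j
  proof
    assume "\<omega> ^ j = 1"
    then have "cis (2 * pi * real j / real L) = cis (2 * pi * real 0 / real L)"
      by (simp add: pow)
    then have "j = 0"
      by (rule inj_onD[OF bij_betw_imp_inj_on[OF bij_betw_roots_unity[OF L]]]) (use that in auto)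
    then show False using that by simp
  qed
  define w where "w = (\<lambda>k i. \<Sum>j<L. \<omega> ^ (k * j) * (?T ^^ j) v i)"
  have T_cvec: "(?T ^^ j) v \<in> cvec d" for j
    using v(1) by (cases j) (auto simp: cvec_def dapply_def)
  have "(\<Sum>k<L. w k i) = of_nat L * v i" for i
  proof -
    have inner: "(\<Sum>k<L. \<omega> ^ (k * j)) = (if j = 0 then of_nat L else 0)" if "j < L" for j
    proof (cases "j = 0")
      case False
      have "(\<Sum>k<L. (\<omega> ^ j) ^ k) = 0"
        by (rule sum_powers_root_of_unity)
          (use \<omega>_neq[of j] that False \<omega>_L in \<open>simp_all add: power_mult[symmetric] mult.commute[of j] power_mult\<close>)
      then show ?thesis using False by (simp add: power_mult[symmetric] mult.commute)
    qed simp
    have "(\<Sum>k<L. w k i) = (\<Sum>j<L. (\<Sum>k<L. \<omega> ^ (k * j)) * (?T ^^ j) v i)"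
      unfolding w_def by (subst sum.swap) (simp add: sum_distrib_right)
    also have "\<dots> = (\<Sum>j<L. if j = 0 then of_nat L * v i else 0)"
      by (intro sum.cong) (auto simp: inner)
    also have "\<dots> = of_nat L * v i" using L by (simp add: sum.delta)
    finally show ?thesis .
  qed
  moreover obtain i where "v i \<noteq> 0" using v(2) by auto
  ultimately have "(\<Sum>k<L. w k i) \<noteq> 0" using L by simp
  then obtain k where "w k i \<noteq> 0" by (meson sum.neutral)
  then have "w k \<noteq> (\<lambda>_. 0)" by auto
  moreover have "w k \<in> cvec d"
    using T_cvec by (simp add: w_def cvec_def)
  moreover have "?T (w k) = (\<lambda>i. inverse (\<omega> ^ k) * w k i)"
  proof
    fix i
    let ?f = "\<lambda>j. \<omega> ^ (k * j) * (?T ^^ j) v i"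
    \<comment> \<open>Applying the operator shifts the summation index by one. The summand has
      period \<open>L\<close>, so the shifted sum equals the original one.\<close>
    have "\<omega> ^ k * ?T (w k) i = (\<Sum>j<L. ?f (Suc j))"
      unfolding w_def dapply_sum by (simp add: sum_distrib_left power_add mult.assoc)
    also have "?f L = ?f 0" using period \<omega>_L by (simp add: power_mult mult.commute[of k])
    then have "(\<Sum>j<L. ?f (Suc j)) = (\<Sum>j<L. ?f j)"
      using sum.lessThan_Suc_shift[of ?f L] by simp
    finally have "\<omega> ^ k * ?T (w k) i = w k i" by (simp add: w_def)
    moreover have "\<omega> ^ k \<noteq> 0" by (simp add: \<omega>_def)
    ultimately show "?T (w k) i = inverse (\<omega> ^ k) * w k i" by (simp add: field_simps)
  qed
  ultimately show thesis by (intro that)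
qed

section \<open>Irreducible representations of a centralizer\<close>

locale centralizer_irrep =
  fixes N :: nat and s :: perm and d :: nat and \<rho> :: "perm \<Rightarrow> nat \<Rightarrow> nat \<Rightarrow> complex"
  assumes s_Sym: "s \<in> Sym N"
    and irreducible: "irreducible_rep (centralizer N s) d \<rho>"
begin

abbreviation act :: "perm \<Rightarrow> (nat \<Rightarrow> complex) \<Rightarrow> (nat \<Rightarrow> complex)" where
  "act \<gamma> \<equiv> dapply d (\<rho> \<gamma>)"

abbreviation (input) "Z \<equiv> centralizer N s"

lemma d_pos: "0 < d"
  using irreducible by (simp add: irreducible_rep_def)

lemma s_in_centralizer: "s \<in> Z"
  using s_Sym by (simp add: centralizer_def)

lemma act_in_cvec: "act \<gamma> v \<in> cvec d"
  by (simp add: dapply_def cvec_def)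

lemma act_id: "v \<in> cvec d \<Longrightarrow> act id v = v"
proof
  fix i assume "v \<in> cvec d"
  moreover have "(\<Sum>k<d. \<rho> id i k * v k) = (\<Sum>k<d. if i = k then v k else 0)" if "i < d"
    using irreducible that by (intro sum.cong) (auto simp: irreducible_rep_def is_rep_def)
  ultimately show "act id v i = v i"
    by (auto simp: dapply_def cvec_def)
qed

lemma act_comp:
  assumes "\<gamma> \<in> Z" "\<delta> \<in> Z"
  shows "act (\<gamma> \<circ> \<delta>) v = act \<gamma> (act \<delta> v)"
proof
  fix i
  show "act (\<gamma> \<circ> \<delta>) v i = act \<gamma> (act \<delta> v) i"
  proof (cases "i < d")
    case True
    then have "act (\<gamma> \<circ> \<delta>) v i = (\<Sum>k<d. \<Sum>l<d. \<rho> \<gamma> i l * \<rho> \<delta> l k * v k)"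
      using irreducible assms
      by (simp add: dapply_def irreducible_rep_def is_rep_def dmult_def sum_distrib_right)
    also have "\<dots> = (\<Sum>l<d. \<rho> \<gamma> i l * (\<Sum>k<d. \<rho> \<delta> l k * v k))"
      by (subst sum.swap) (simp add: sum_distrib_left mult.assoc)
    also have "\<dots> = act \<gamma> (act \<delta> v) i" using True by (simp add: dapply_def)
    finally show ?thesis .
  qed (simp add: dapply_def)
qed

lemma act_scale: "act \<gamma> (\<lambda>i. c * v i) = (\<lambda>i. c * act \<gamma> v i)"
  by (auto simp: dapply_def sum_distrib_left mult.left_commute)

lemma act_add: "act \<gamma> (\<lambda>i. v i + w i) = (\<lambda>i. act \<gamma> v i + act \<gamma> w i)"
  by (auto simp: dapply_def sum.distrib algebra_simps)

lemma cvec_scale: "v \<in> cvec d \<Longrightarrow> (\<lambda>i. c * v i) \<in> cvec d"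
  by (simp add: cvec_def)

lemma cvec_add: "v \<in> cvec d \<Longrightarrow> w \<in> cvec d \<Longrightarrow> (\<lambda>i. v i + w i) \<in> cvec d"
  by (simp add: cvec_def)

lemma invariant_subspace_eq:
  assumes "csubspace d W" "\<And>\<gamma> v. \<gamma> \<in> Z \<Longrightarrow> v \<in> W \<Longrightarrow> act \<gamma> v \<in> W"
    and "v \<in> W" "v \<noteq> (\<lambda>_. 0)"
  shows "W = cvec d"
  using irreducible assms unfolding irreducible_rep_def by blast

lemma nonzero_cvec: obtains v :: "nat \<Rightarrow> complex" where "v \<in> cvec d" "v \<noteq> (\<lambda>_. 0)"
proof (rule that[of "\<lambda>i. if i = 0 then 1 else 0"])
  show "(\<lambda>i::nat. if i = 0 then 1 else (0::complex)) \<noteq> (\<lambda>_. 0)"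
    by (metis one_neq_zero)
qed (use d_pos in \<open>simp add: cvec_def\<close>)

lemma eigenvector_exists:
  assumes z: "z \<in> Z" and L: "0 < L" "z ^^ L = id"
  obtains v c where "v \<in> cvec d" "v \<noteq> (\<lambda>_. 0)" "act z v = (\<lambda>i. c * v i)"
proof -
  obtain v :: "nat \<Rightarrow> complex" where v: "v \<in> cvec d" "v \<noteq> (\<lambda>_. 0)"
    by (rule nonzero_cvec)
  have "z ^^ j \<in> Z \<and> act (z ^^ j) v = (act z ^^ j) v" for j
  proof (induction j)
    case 0
    have "id \<in> Z" by (simp add: centralizer_def Sym_id)
    then show ?case using act_id[OF v(1)] by (simp add: id_def)
  next
    case (Suc j)
    then show ?case unfolding funpow.simps(2)
      using act_comp[OF z, of "z ^^ j" v] centralizer_comp[OF z, of "z ^^ j"] by (metis comp_apply)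
  qed
  then have "(act z ^^ L) v = v" using L(2) act_id[OF v(1)] by metis
  then show thesis using eigenvector_of_finite_order[OF L(1) v] that by metis
qed

text \<open>Schur's lemma: the eigenspace of a central element is invariant, hence everything.
  Finite order provides the first eigenvector.\<close>

lemma central_acts_by_scalar:
  assumes "z \<in> Z" "0 < L" "z ^^ L = id" "\<And>\<gamma>. \<gamma> \<in> Z \<Longrightarrow> z \<circ> \<gamma> = \<gamma> \<circ> z"
  obtains c where "\<And>v. v \<in> cvec d \<Longrightarrow> act z v = (\<lambda>i. c * v i)"
proof -
  obtain w c where w: "w \<in> cvec d" "w \<noteq> (\<lambda>_. 0)" "act z w = (\<lambda>i. c * w i)"
    by (rule eigenvector_exists[OF assms(1-3)])
  define W where "W = {v \<in> cvec d. act z v = (\<lambda>i. c * v i)}"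
  have "csubspace d W"
    by (auto simp: csubspace_def W_def act_add act_scale cvec_add cvec_scale algebra_simps)
      (auto simp: cvec_def dapply_def)
  moreover have "act \<gamma> v \<in> W" if "\<gamma> \<in> Z" "v \<in> W" for \<gamma> v
  proof -
    have "act z (act \<gamma> v) = act \<gamma> (act z v)"
      using act_comp assms that(1) by metis
    then show ?thesis using that(2) by (simp add: W_def act_in_cvec act_scale)
  qed
  ultimately have "W = cvec d"
    by (rule invariant_subspace_eq[of W w]) (use w in \<open>simp_all add: W_def\<close>)
  then show thesis using that by (auto simp: W_def)
qed

text \<open>By irreducibility the line through \<open>v\<close> is the whole space, but in degree at
  least 2 the first two coordinate vectors do not lie on one line.\<close>

lemma invariant_line_degree_one:
  assumes v: "v \<in> cvec d" "v \<noteq> (\<lambda>_. 0)"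
    and inv: "\<And>\<gamma>. \<gamma> \<in> Z \<Longrightarrow> \<exists>c. act \<gamma> v = (\<lambda>i. c * v i)"
  shows "d = 1"
proof -
  define W where "W = {(\<lambda>i. c * v i) |c. True}"
  have "W = cvec d"
  proof (rule invariant_subspace_eq)
    show "csubspace d W"
      unfolding csubspace_def W_def using v(1)
      by (auto simp: cvec_def)
        (metis mult_zero_left, metis distrib_right, metis mult.assoc)
    show "act \<gamma> w \<in> W" if "\<gamma> \<in> Z" "w \<in> W" for \<gamma> w
      using that inv[of \<gamma>] by (auto simp: W_def act_scale) (metis mult.assoc)
    show "v \<in> W" unfolding W_def by (auto intro!: exI[of _ 1])
  qed (rule v)
  have "\<not> 1 < d"
  proof
    assume "1 < d"
    define e where "e = (\<lambda>(j :: nat) i. if i = j then 1 else (0 :: complex))"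
    have "e 0 \<in> W" "e 1 \<in> W"
      using \<open>1 < d\<close> unfolding \<open>W = cvec d\<close> by (auto simp: e_def cvec_def)
    then obtain a b where "e 0 = (\<lambda>i. a * v i)" "e 1 = (\<lambda>i. b * v i)"
      by (auto simp: W_def)
    from fun_cong[OF this(1)] fun_cong[OF this(2)] have "a * v 0 = 1" "a * v 1 = 0" "b * v 1 = 1"
      by (metis e_def, metis e_def one_neq_zero, metis e_def)
    then show False by auto
  qed
  then show ?thesis using d_pos by simp
qed

text \<open>Since \<open>u\<close> squares to the identity, \<open>u + e\<close> maps into the
  eigenspace of \<open>e\<close>. It does not kill \<open>v\<close> when \<open>v\<close> is no
  eigenvector for \<open>- e\<close>.\<close>

lemma involution_eigenvectors:
  assumes u: "u \<in> Z" "u \<circ> u = id"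
    and nonscalar: "\<And>c. \<exists>v\<in>cvec d. act u v \<noteq> (\<lambda>i. c * v i)"
    and e: "e = 1 \<or> e = -1"
  obtains w where "w \<in> cvec d" "w \<noteq> (\<lambda>_. 0)" "act u w = (\<lambda>i. e * w i)"
proof -
  obtain v where v: "v \<in> cvec d" "act u v \<noteq> (\<lambda>i. - e * v i)"
    using nonscalar by blast
  define w where "w = (\<lambda>i. act u v i + e * v i)"
  have "act u (act u v) = v"
    using act_comp[OF u(1) u(1), of v] u(2) act_id[OF v(1)] by simp
  then have "act u w = (\<lambda>i. e * w i)"
    using e by (auto simp: w_def act_add act_scale)
  moreover have "w \<noteq> (\<lambda>_. 0)"
    using v(2) by (auto simp: w_def fun_eq_iff add_eq_0_iff2)
  moreover have "w \<in> cvec d"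
    unfolding w_def by (intro cvec_add cvec_scale act_in_cvec v)
  ultimately show thesis using that by blast
qed

end

section \<open>Diagonal braidings inside the Yetter-Drinfeld module\<close>

locale yetter_drinfeld_irrep = centralizer_irrep +
  fixes G :: "perm \<Rightarrow> perm"
  assumes transversal: "t \<in> conj_class N s \<Longrightarrow> G t \<in> Sym N \<and> G t \<circ> s \<circ> inv (G t) = t"
begin

text \<open>The transversal \<open>G\<close> is arbitrary, so eigenvalues are computed with
  convenient conjugators \<open>k i\<close>. As \<open>k i\<close> and \<open>G (t i)\<close> both
  conjugate \<open>s\<close> to \<open>t i\<close>, they differ by an element of the centralizer,
  and its action transports the eigenvectors.\<close>

lemma diagonal_family_of_eigenvectors:
  assumes k: "\<And>i. i \<in> I \<Longrightarrow> k i \<in> Sym N"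
    and t: "\<And>i. i \<in> I \<Longrightarrow> t i = k i \<circ> s \<circ> inv (k i)"
    and inj: "inj_on t I"
    and comm: "\<And>i j. i \<in> I \<Longrightarrow> j \<in> I \<Longrightarrow> t i \<circ> t j = t j \<circ> t i"
    and w: "\<And>i. i \<in> I \<Longrightarrow> w i \<in> cvec d" "\<And>i. i \<in> I \<Longrightarrow> w i \<noteq> (\<lambda>_. 0)"
    and eig: "\<And>i j. i \<in> I \<Longrightarrow> j \<in> I \<Longrightarrow>
      act (inv (k j) \<circ> t i \<circ> k j) (w j) = (\<lambda>a. q i j * w j a)"
  shows "diagonal_family (conj_class N s) d G \<rho> I t (\<lambda>j. act (inv (G (t j)) \<circ> k j) (w j)) q"
proof -
  have tC: "t i \<in> conj_class N s" if "i \<in> I" for i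
    using k[OF that] t[OF that] by (auto simp: conj_class_def)
  have tS: "t i \<in> Sym N" if "i \<in> I" for i
    unfolding t[OF that] by (intro Sym_comp Sym_inv k that s_Sym)
  have GS: "G (t i) \<in> Sym N" if "i \<in> I" for i using transversal[OF tC[OF that]] by blast
  have tk: "t i (k i x) = k i (s x)" if "i \<in> I" for i x
    using t[OF that] by (simp add: Sym_inverses[OF k[OF that]])
  have tG: "t i (G (t i) x) = G (t i) (s x)" if "i \<in> I" for i x
    using transversal[OF tC[OF that]] Sym_inverses[OF GS[OF that]] by (metis comp_apply)
  have Gt: "inv (G (t i)) (t i x) = s (inv (G (t i)) x)" if "i \<in> I" for i x
    using tG[OF that, of "inv (G (t i)) x"] Sym_inverses[OF GS[OF that]] by metis
  have kt: "inv (k i) (t i x) = s (inv (k i) x)" if "i \<in> I" for i x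
    using tk[OF that, of "inv (k i) x"] Sym_inverses[OF k[OF that]] by metis
  define \<gamma> where "\<gamma> = (\<lambda>i. inv (G (t i)) \<circ> k i)"
  have \<gamma>: "\<gamma> i \<in> Z" if "i \<in> I" for i
    using that by (auto simp: \<gamma>_def centralizer_def Sym_comp Sym_inv GS k tk[symmetric] Gt)
  have \<beta>: "inv (k j) \<circ> t i \<circ> k j \<in> Z" if "i \<in> I" "j \<in> I" for i j
  proof -
    have "t i (t j x) = t j (t i x)" for x using comm[OF that] by (metis comp_apply)
    then show ?thesis using that
      by (auto simp: centralizer_def Sym_comp Sym_inv tS k tk[symmetric] kt[symmetric])
  qed
  have act_\<gamma>: "act (inv (G (t j)) \<circ> t i \<circ> G (t j)) (act (\<gamma> j) (w j)) = (\<lambda>a. q i j * act (\<gamma> j) (w j) a)"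
    if "i \<in> I" "j \<in> I" for i j
  proof -
    have eq: "inv (G (t j)) \<circ> t i \<circ> G (t j) \<circ> \<gamma> j = \<gamma> j \<circ> (inv (k j) \<circ> t i \<circ> k j)"
      using that by (auto simp: \<gamma>_def fun_eq_iff Sym_inverses[OF GS] Sym_inverses[OF k])
    have "t i (t j x) = t j (t i x)" for x using comm[OF that] by (metis comp_apply)
    then have Z: "inv (G (t j)) \<circ> t i \<circ> G (t j) \<in> Z" using that
      by (auto simp: centralizer_def Sym_comp Sym_inv tS GS tG[symmetric] Gt[symmetric])
    have "act (inv (G (t j)) \<circ> t i \<circ> G (t j)) (act (\<gamma> j) (w j))
      = act (\<gamma> j) (act (inv (k j) \<circ> t i \<circ> k j) (w j))"
      using act_comp[OF Z \<gamma>[OF that(2)]] act_comp[OF \<gamma>[OF that(2)] \<beta>[OF that]] eq by simp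
    then show ?thesis by (simp add: eig[OF that] act_scale)
  qed
  show ?thesis
  proof
    fix i assume i: "i \<in> I"
    show "t i \<in> conj_class N s" by (rule tC[OF i])
    show "bij (t i)" by (rule Sym_bij[OF tS[OF i]])
    have "act (\<gamma> i) (w i) \<noteq> (\<lambda>_. 0)"
    proof
      assume *: "act (\<gamma> i) (w i) = (\<lambda>_. 0)"
      have "inv (\<gamma> i) \<circ> \<gamma> i = id"
        using \<gamma>[OF i] by (auto simp: centralizer_def Sym_inverses fun_eq_iff)
      then have "w i = act (inv (\<gamma> i)) (act (\<gamma> i) (w i))"
        using act_comp[OF centralizer_inv[OF \<gamma>[OF i]] \<gamma>[OF i]] act_id[OF w(1)[OF i]] by simp
      also have "\<dots> = (\<lambda>_. 0)" unfolding * by (auto simp: dapply_def)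
      finally show False using w(2)[OF i] by simp
    qed
    then obtain a where "act (\<gamma> i) (w i) a \<noteq> 0" by (auto simp: fun_eq_iff)
    then show "\<exists>a<d. act (inv (G (t i)) \<circ> k i) (w i) a \<noteq> 0"
      unfolding \<gamma>_def by (intro exI[of _ a]) (auto simp: dapply_def split: if_splits)
    fix j assume j: "j \<in> I"
    show "t i \<circ> t j \<circ> inv (t i) = t j"
      unfolding comm[OF i j] by (auto simp: Sym_inverses[OF tS[OF i]])
    fix a assume "a < d"
    then show "(\<Sum>b<d. \<rho> (inv (G (t j)) \<circ> t i \<circ> G (t j)) a b * act (inv (G (t j)) \<circ> k j) (w j) b)
        = q i j * act (inv (G (t j)) \<circ> k j) (w j) a"
      using fun_cong[OF act_\<gamma>[OF i j], of a] by (simp add: \<gamma>_def dapply_def)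
  qed (use finite_conj_class[OF s_Sym] inj in auto)
qed

text \<open>For \<open>c = 1\<close> one letter at \<open>s\<close> has self-braiding 1. Otherwise
  letters at \<open>s\<close> and \<open>inv s\<close> braid by \<open>c\<close> on the diagonal and
  \<open>inverse c\<close> off it; the total self-braiding is 1, and the square of
  \<open>inverse c\<close> is not 1 because \<open>c\<close> is neither 1 nor -1.\<close>

lemma nichols_dim_infinite_not_minus_one:
  assumes h: "h \<in> Sym N" "h \<circ> s \<circ> inv h = inv s" and s: "s \<noteq> inv s"
    and scalar: "\<And>v. v \<in> cvec d \<Longrightarrow> act s v = (\<lambda>i. c * v i)" and c: "c \<noteq> -1"
  shows "nichols_dim (conj_class N s) d G \<rho> = \<infinity>"
proof -
  obtain w :: "nat \<Rightarrow> complex" where w: "w \<in> cvec d" "w \<noteq> (\<lambda>_. 0)"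
    by (rule nonzero_cvec)
  show ?thesis
  proof (cases "c = 1")
    case True
    interpret diagonal_family "conj_class N s" d G \<rho> "{0}" "\<lambda>_. s"
      "\<lambda>j. act (inv (G s) \<circ> id) w" "\<lambda>_ _. c"
      by (rule diagonal_family_of_eigenvectors[where k = "\<lambda>_. id" and w = "\<lambda>_. w"])
        (use w in \<open>auto simp: Sym_id scalar\<close>)
    show ?thesis by (rule nichols_dim_infinite_one_letter[of 0]) (auto simp: True)
  next
    case False
    have si: "inv s \<circ> s = id" by (auto simp: Sym_inverses[OF s_Sym])
    have sZ: "s \<in> Z" by (rule s_in_centralizer)
    have inv_act: "(\<lambda>i. c * act (inv s) v i) = v" if "v \<in> cvec d" for v
      using act_comp[OF centralizer_inv[OF sZ] sZ, of v] si that
      by (simp add: scalar act_scale act_id)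
    have "c \<noteq> 0" using inv_act[OF w(1)] w(2) by auto
    then have inv_act': "act (inv s) w = (\<lambda>i. inverse c * w i)"
      using inv_act[OF w(1)] by (auto simp: fun_eq_iff field_simps)
    define t where "t = (\<lambda>i::nat. if i = 0 then s else inv s)"
    define k where "k = (\<lambda>i::nat. if i = 0 then id else h)"
    have h1: "h (s x) = inv s (h x)" for x
      using h Sym_inverses[OF h(1)] by (metis comp_apply)
    have h2: "inv h (s x) = inv s (inv h x)" for x
      using h1[of "inv s (inv h x)"] Sym_inverses[OF h(1)] Sym_inverses[OF s_Sym] by metis
    have h3: "inv h (inv s x) = s (inv h x)" for x
      using h2[of "inv s x"] Sym_inverses[OF s_Sym] by metis
    interpret diagonal_family "conj_class N s" d G \<rho> "{0, 1}" t
      "\<lambda>j. act (inv (G (t j)) \<circ> k j) w" "\<lambda>i j. if i = j then c else inverse c"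
    proof (rule diagonal_family_of_eigenvectors)
      show "inj_on t {0, 1}" using s by (auto simp: t_def)
      show "act (inv (k j) \<circ> t i \<circ> k j) w = (\<lambda>a. (if i = j then c else inverse c) * w a)"
        if "i \<in> {0, 1}" "j \<in> {0, 1}" for i j
      proof -
        have "inv h \<circ> s \<circ> h = inv s" "inv h \<circ> inv s \<circ> h = s"
          by (auto simp: h2 h3 Sym_inverses[OF h(1)])
        then show ?thesis using that
          by (auto simp: k_def t_def scalar[OF w(1)] inv_act')
      qed
    qed (use w h in \<open>auto simp: k_def t_def Sym_id Sym_inverses[OF s_Sym]\<close>)
    have "c * inverse c * inverse c * c = 1" "inverse c * inverse c \<noteq> 1"
      using c False \<open>c \<noteq> 0\<close> by (auto simp: field_simps power2_eq_1_iff simp flip: power2_eq_square)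
    then show ?thesis by (intro nichols_dim_infinite_two_letters[of 0 1]) simp_all
  qed
qed

text \<open>Conjugating \<open>s\<close> by the identity, \<open>f\<close>, \<open>h\<close> and
  \<open>h \<circ> f\<close> gives the commuting elements \<open>s\<close>,
  \<open>s \<circ> u\<close>, \<open>inv s\<close> and \<open>inv s \<circ> u\<close>, which carry
  the letters 0 to 3.\<close>

lemma nichols_dim_infinite_minus_one:
  assumes u: "u \<in> Z" "u \<circ> u = id" and s: "s \<noteq> inv s"
    and nonscalar: "\<And>c. \<exists>v\<in>cvec d. act u v \<noteq> (\<lambda>i. c * v i)"
    and u_neq: "u \<noteq> id" "s \<circ> u \<noteq> inv s"
    and f: "f \<in> Sym N" "f \<circ> f = id" "f \<circ> s \<circ> f = s \<circ> u" "f \<circ> u = u \<circ> f"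
    and h: "h \<in> Sym N" "h \<circ> h = id" "h \<circ> s \<circ> h = inv s" "h \<circ> u = u \<circ> h"
    and scalar: "\<And>v. v \<in> cvec d \<Longrightarrow> act s v = (\<lambda>i. - v i)"
  shows "nichols_dim (conj_class N s) d G \<rho> = \<infinity>"
proof -
  define s' where "s' = inv s"
  have uS: "u \<in> Sym N" using u(1) by (simp add: centralizer_def)
  have [simp]: "s (s' x) = x" "s' (s x) = x" for x
    by (auto simp: s'_def Sym_inverses[OF s_Sym])
  have [simp]: "u (u x) = x" "f (f x) = x" "h (h x) = x" for x
    using u(2) f(2) h(2) by (metis comp_apply id_apply)+
  have us [simp]: "u (s x) = s (u x)" for x
    using u(1) by (simp add: centralizer_def fun_eq_iff)
  have us' [simp]: "u (s' x) = s' (u x)" for x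
    using us[of "s' x"] by (metis \<open>\<And>x. s (s' x) = x\<close> \<open>\<And>x. s' (s x) = x\<close>)
  have fu [simp]: "f (u x) = u (f x)" and hu [simp]: "h (u x) = u (h x)" for x
    using f(4) h(4) by (metis comp_apply)+
  have fs [simp]: "f (s x) = s (u (f x))" for x
    using fun_cong[OF f(3), of "f x"] by simp
  have fs' [simp]: "f (s' x) = s' (u (f x))" for x
    using fs[of "s' x"] by (metis \<open>\<And>x. s' (s x) = x\<close> \<open>\<And>x. s (s' x) = x\<close> us \<open>\<And>x. u (u x) = x\<close>)
  have hs [simp]: "h (s x) = s' (h x)" for x
    using fun_cong[OF h(3), of "h x"] by (simp add: s'_def)
  have hs' [simp]: "h (s' x) = s (h x)" for x
    using hs[of "s' x"] by (metis \<open>\<And>x. s (s' x) = x\<close>)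
  have inv_f: "inv f = f" and inv_h: "inv h = h" and inv_hf: "inv (h \<circ> f) = f \<circ> h"
    by (auto intro!: inv_unique_comp)
  obtain wm where wm: "wm \<in> cvec d" "wm \<noteq> (\<lambda>_. 0)" "act u wm = (\<lambda>i. (-1) * wm i)"
    by (rule involution_eigenvectors[OF u nonscalar, of "-1"]) auto
  obtain wp where wp: "wp \<in> cvec d" "wp \<noteq> (\<lambda>_. 0)" "act u wp = (\<lambda>i. 1 * wp i)"
    by (rule involution_eigenvectors[OF u nonscalar, of 1]) auto
  \<comment> \<open>Even letters get a vector with \<open>u = -1\<close>, odd ones with
    \<open>u = 1\<close>. By \<open>conj\<close> below, \<open>u\<close> enters the action of letter
    \<open>i\<close> on letter \<open>j\<close> exactly when the parities differ, so the sign -1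
    coming from \<open>s\<close> or its inverse is reversed only for odd \<open>i\<close> and even
    \<open>j\<close>.\<close>
  define w where "w = (\<lambda>i::nat. if odd i then wp else wm)"
  define t where "t = (\<lambda>i::nat. (if i < 2 then s else s') \<circ> (if odd i then u else id))"
  define k where "k = (\<lambda>i::nat. (if i < 2 then id else h) \<circ> (if odd i then f else id))"
  have sZ: "s \<in> Z" and s'Z: "s' \<in> Z"
    unfolding s'_def by (intro centralizer_inv s_in_centralizer)+
  have act_s': "act s' v = (\<lambda>i. - v i)" if "v \<in> cvec d" for v
  proof -
    have "v = act s' (act s v)"
      using act_comp[OF s'Z sZ, of v] act_id[OF that] by (simp add: s'_def fun_eq_iff Sym_inverses[OF s_Sym] comp_def id_def)
    also have "\<dots> = (\<lambda>i. - act s' v i)"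
      using act_scale[of s' "-1" v] by (simp add: scalar[OF that])
    finally show ?thesis by (metis minus_equation_iff)
  qed
  have conj: "inv (k j) \<circ> t i \<circ> k j =
      (if i < 2 \<longleftrightarrow> j < 2 then s else s') \<circ> (if odd i \<longleftrightarrow> even j then u else id)" for i j
    by (auto simp: k_def t_def inv_f inv_h inv_hf fun_eq_iff)
  have sign: "act ((if b then s else s') \<circ> (if e then u else id)) v
      = (\<lambda>a. - (if e then act u v a else v a))" if "v \<in> cvec d" for b e v
    using that act_comp[OF sZ u(1)] act_comp[OF s'Z u(1)] scalar[OF act_in_cvec] act_s'[OF act_in_cvec]
    by (auto simp: scalar act_s')
  interpret diagonal_family "conj_class N s" d G \<rho> "{0, 1, 2, 3}" t
    "\<lambda>j. act (inv (G (t j)) \<circ> k j) (w j)" "\<lambda>i j. if odd i \<and> even j then 1 else -1"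
  proof (rule diagonal_family_of_eigenvectors)
    have s_inj: "s \<circ> a = s \<circ> b \<longleftrightarrow> a = b" "s' \<circ> a = s' \<circ> b \<longleftrightarrow> a = b" for a b
      by (metis \<open>\<And>x. s' (s x) = x\<close> comp_apply ext, metis \<open>\<And>x. s (s' x) = x\<close> comp_apply ext)
    have n1: "s \<noteq> s \<circ> u" "s' \<noteq> s' \<circ> u"
      using s_inj[of id u] u_neq(1) by auto
    have n2: "s \<circ> u \<noteq> s' \<circ> u"
    proof
      assume "s \<circ> u = s' \<circ> u"
      then have "s \<circ> u \<circ> u = s' \<circ> u \<circ> u" by simp
      then show False using s by (simp add: comp_assoc u(2) s'_def)
    qed
    have n3: "s \<noteq> s' \<circ> u"
    proof
      assume "s = s' \<circ> u"
      then have "s \<circ> u = s' \<circ> u \<circ> u" by simp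
      then show False using u_neq(2) by (simp add: comp_assoc u(2) s'_def)
    qed
    show "inj_on t {0, 1, 2, 3}"
      using n1 n2 n3 s u_neq(2)
      by (auto simp: t_def s'_def[symmetric])
    show "t i = k i \<circ> s \<circ> inv (k i)" for i
      by (auto simp: t_def k_def inv_f inv_h inv_hf fun_eq_iff)
    show "t i \<circ> t j = t j \<circ> t i" for i j
      by (auto simp: t_def fun_eq_iff)
    show "act (inv (k j) \<circ> t i \<circ> k j) (w j) = (\<lambda>a. (if odd i \<and> even j then 1 else -1) * w j a)" for i j
      unfolding conj by (subst sign) (auto simp: w_def wm wp)
  qed (use wm wp f h in \<open>auto simp: k_def w_def Sym_id Sym_comp\<close>)
  show ?thesis by (rule nichols_dim_infinite_four_letters) auto
qed

end

section \<open>Permutations with cycles of equal even length\<close>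

locale equal_cycles =
  fixes N L :: nat and \<pi> :: perm
  assumes \<pi>_Sym: "\<pi> \<in> Sym N"
    and L: "4 \<le> L" "even L"
    and period: "x < N \<Longrightarrow> (\<pi> ^^ L) x = x"
    and minimal: "x < N \<Longrightarrow> 0 < k \<Longrightarrow> k < L \<Longrightarrow> (\<pi> ^^ k) x \<noteq> x"
begin

lemma Sym_outside: "p \<in> Sym N \<Longrightarrow> \<not> x < N \<Longrightarrow> p x = x"
  by (auto simp: Sym_def permutes_def)

lemma Sym_less_iff [simp]: "p \<in> Sym N \<Longrightarrow> p x < N \<longleftrightarrow> x < N"
  using permutes_in_image[of p "{..<N}" x] by (simp add: Sym_def)

definition pw :: "nat \<Rightarrow> nat \<Rightarrow> nat" where "pw k = \<pi> ^^ k"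

lemma pw_simps [simp]: "pw 0 x = x" "pw j (pw k x) = pw (j + k) x" "\<pi> (pw k x) = pw (Suc k) x"
  by (simp_all add: pw_def funpow_add)

lemma pw_\<pi> [simp]: "pw k (\<pi> x) = pw (Suc k) x"
  using pw_simps(2)[of k 1 x] by (simp add: pw_def)

lemma pw_Sym: "pw k \<in> Sym N"
proof (induction k)
  case (Suc k)
  then show ?case using Sym_comp[OF \<pi>_Sym] by (simp only: pw_def funpow.simps)
qed (use Sym_id in \<open>simp add: pw_def id_def\<close>)

lemma pw_outside: "\<not> x < N \<Longrightarrow> pw k x = x"
  by (rule Sym_outside[OF pw_Sym])

lemma pw_L [simp]: "pw L x = x"
  using period pw_outside by (cases "x < N") (auto simp: pw_def)

lemma pw_mult_L [simp]: "pw (k * L) x = x" "pw (L * k) x = x"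
proof -
  show "pw (k * L) x = x"
    by (induction k) (simp_all flip: pw_simps(2))
  then show "pw (L * k) x = x" by (simp add: mult.commute)
qed

lemma pw_mod: "pw (k mod L) x = pw k x"
proof -
  have "pw k x = pw (k mod L + L * (k div L)) x" by simp
  also have "\<dots> = pw (k mod L) x" by (simp only: pw_simps(2)[symmetric] pw_mult_L)
  finally show ?thesis ..
qed

text \<open>A coincidence at two distinct residues would bring a point back to itself in fewer than
  \<open>L\<close> steps.\<close>

lemma pw_eq_iff:
  assumes "x < N"
  shows "pw j x = pw k x \<longleftrightarrow> j mod L = k mod L"
proof
  have *: "j mod L = k mod L" if "pw j x = pw k x" "j mod L \<le> k mod L" for j k
  proof (rule ccontr)
    assume "j mod L \<noteq> k mod L"
    then have less: "j mod L < k mod L" using that(2) by simp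
    define y where "y = pw (j mod L) x"
    have "pw (k mod L - j mod L) y = pw (k mod L - j mod L + j mod L) x"
      unfolding y_def by (rule pw_simps(2))
    also have "\<dots> = pw (k mod L) x" using less by simp
    also have "\<dots> = y" using that(1) by (simp add: y_def pw_mod)
    finally have "pw (k mod L - j mod L) y = y" .
    moreover have "y < N" using assms by (simp add: y_def pw_Sym)
    moreover have "k mod L - j mod L < L"
      using L by (simp add: less_imp_diff_less)
    ultimately show False using minimal[of y "k mod L - j mod L"] less by (simp add: pw_def)
  qed
  show "j mod L = k mod L" if "pw j x = pw k x"
    using *[of j k] *[of k j] that by (metis nle_le)
  show "pw j x = pw k x" if "j mod L = k mod L"
    using that by (metis pw_mod)
qed

definition orb :: "nat \<Rightarrow> nat set" where "orb x = range (\<lambda>k. pw k x)"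

lemma self_in_orb [simp]: "x \<in> orb x"
  unfolding orb_def using pw_simps(1) by (metis rangeI)

lemma orb_pw [simp]: "orb (pw k x) = orb x"
proof -
  have "pw j x \<in> orb (pw k x)" for j
  proof -
    \<comment> \<open>The exponent \<open>k * L - k\<close> is a natural number acting as
      \<open>-k\<close>.\<close>
    have "k \<le> k * L" using L by simp
    then have "j + (k * L - k) + k = j + k * L" by linarith
    then have "pw (j + (k * L - k)) (pw k x) = pw j (pw (k * L) x)" by (simp only: pw_simps(2))
    then have "pw j x = pw (j + (k * L - k)) (pw k x)" by (simp only: pw_mult_L)
    then show ?thesis unfolding orb_def by blast
  qed
  then show ?thesis by (auto simp: orb_def)
qed

lemma pw_in_orb_iff [simp]: "pw k x \<in> orb y \<longleftrightarrow> x \<in> orb y"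
  by (metis orb_pw orb_def rangeE self_in_orb)

lemma orb_eq: "y \<in> orb x \<Longrightarrow> orb y = orb x"
  by (auto simp: orb_def[of x])

lemma in_orb_sym: "y \<in> orb x \<longleftrightarrow> x \<in> orb y"
  using orb_eq self_in_orb by metis

lemma centralizer_pw: "\<gamma> \<in> centralizer N \<pi> \<Longrightarrow> \<gamma> (pw k x) = pw k (\<gamma> x)"
proof (induction k)
  case (Suc k)
  then have "\<gamma> \<circ> \<pi> = \<pi> \<circ> \<gamma>" by (simp add: centralizer_def)
  then have "\<gamma> (\<pi> (pw k x)) = \<pi> (\<gamma> (pw k x))" by (metis comp_apply)
  with Suc show ?case by simp
qed simp

lemma \<pi>_power_L: "\<pi> ^^ L = id"
  using pw_L by (auto simp: pw_def)

lemma inv_\<pi>: "inv \<pi> = pw (L - 1)"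
  using L by (intro inv_unique_comp) (auto simp: fun_eq_iff)

lemma involution_Sym:
  assumes "\<And>x. p (p x) = x" "\<And>x. \<not> x < N \<Longrightarrow> p x = x"
  shows "p \<in> Sym N"
proof -
  have "\<exists>!x. p x = y" for y
    by (rule ex1I[of _ "p y"]) (use assms(1) in auto)
  then show ?thesis using assms(2) by (simp add: Sym_def permutes_def)
qed

end

section \<open>Swapping, half swapping and reflecting cycles\<close>

locale two_orbits = equal_cycles +
  fixes a b :: nat
  assumes a: "a < N" and b: "b < N" and distinct: "b \<notin> orb a"
begin

lemma distinct': "a \<notin> orb b"
  using distinct in_orb_sym by blast

text \<open>The given points \<open>a\<close> and \<open>b\<close> serve as base points of their
  cycles, so that \<open>swap\<close> matches points of equal phase.\<close>

definition base :: "nat \<Rightarrow> nat" where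
  "base x = (if x \<in> orb a then a else if x \<in> orb b then b else (LEAST y. y \<in> orb x))"

text \<open>For points below \<open>N\<close> the phase is determined modulo \<open>L\<close> only;
  its parity is meaningful there because \<open>L\<close> is even.\<close>

definition phase :: "nat \<Rightarrow> nat" where
  "phase x = (SOME k. x = pw k (base x))"

definition swap :: perm where
  "swap x = (if x \<in> orb a then pw (phase x) b else if x \<in> orb b then pw (phase x) a else x)"

text \<open>Conjugates \<open>\<pi>\<close> to \<open>\<pi> \<circ> swap\<close>, since exactly one of \<open>x\<close> and \<open>\<pi> x\<close> has odd phase.\<close>

definition half_swap :: perm where
  "half_swap x = (if x < N \<and> odd (phase x) then swap x else x)"

text \<open>Reversal of each cycle about its base point, with \<open>L - 1\<close> in the role of -1
  modulo \<open>L\<close>.\<close>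

definition reflect :: perm where
  "reflect x = pw ((L - 1) * phase x) (base x)"

lemma base_pw [simp]: "base (pw k x) = base x"
  by (simp add: base_def)

lemma base_in_orb: "base x \<in> orb x"
proof -
  have "(LEAST y. y \<in> orb x) \<in> orb x" by (rule LeastI) (rule self_in_orb)
  then show ?thesis by (metis base_def in_orb_sym)
qed

lemma pw_phase: "pw (phase x) (base x) = x"
proof -
  have "x \<in> orb (base x)" using base_in_orb in_orb_sym by blast
  then have "\<exists>k. x = pw k (base x)" by (auto simp: orb_def)
  then show ?thesis unfolding phase_def by (rule someI2_ex) simp
qed

lemma base_ab [simp]: "base a = a" "base b = b"
  using distinct by (auto simp: base_def)

lemma base_idem: "base (base x) = base x"
  using base_in_orb[of x] by (auto simp: orb_def)

lemma base_less: "base x < N \<longleftrightarrow> x < N"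
  by (metis pw_phase pw_Sym Sym_less_iff)

lemma phase_pw:
  assumes "x < N"
  shows "phase (pw k x) mod L = (phase x + k) mod L"
proof -
  have "pw (phase (pw k x)) (base x) = pw k x"
    using pw_phase[of "pw k x"] by simp
  also have "\<dots> = pw (phase x + k) (base x)"
    using pw_phase[of x] by (metis pw_simps(2) add.commute)
  finally show ?thesis using assms by (simp add: pw_eq_iff base_less)
qed

lemma phase_base: "x < N \<Longrightarrow> base x = x \<Longrightarrow> phase x mod L = 0"
  using pw_phase[of x] pw_eq_iff[of x "phase x" 0] by simp

lemma even_mod_L: "j mod L = k mod L \<Longrightarrow> even j \<longleftrightarrow> even k"
  using L(2) by (metis dvd_mod_iff)

lemma phase_pw_base:
  assumes "x < N" "base x = x"
  shows "phase (pw k x) mod L = k mod L"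
  using phase_pw[OF assms(1), of k] phase_base[OF assms] by (metis add_0 mod_add_left_eq)

lemma pw_phase_base: "base x = x \<Longrightarrow> x < N \<Longrightarrow> pw (phase (pw k x)) y = pw k y"
  using phase_pw_base pw_mod by metis

lemma swap_pw [simp]: "swap (pw k a) = pw k b" "swap (pw k b) = pw k a"
  using distinct distinct' a b by (auto simp: swap_def pw_phase_base)

lemma swap_other: "x \<notin> orb a \<Longrightarrow> x \<notin> orb b \<Longrightarrow> swap x = x"
  by (simp add: swap_def)

lemma cases_orb:
  obtains k where "x = pw k a" | k where "x = pw k b" | "x \<notin> orb a" "x \<notin> orb b"
  unfolding orb_def by blast

lemma swap_swap [simp]: "swap (swap x) = x"
  by (rule cases_orb[of x]) (auto simp: swap_other)

lemma swap_\<pi>: "swap (\<pi> x) = \<pi> (swap x)"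
proof (rule cases_orb[of x])
  assume *: "x \<notin> orb a" "x \<notin> orb b"
  then have "pw 1 x \<notin> orb a" "pw 1 x \<notin> orb b" by (simp_all del: One_nat_def)
  with * show ?thesis by (simp add: swap_other pw_def)
qed auto

lemma swap_outside: "\<not> x < N \<Longrightarrow> swap x = x"
  by (rule cases_orb[of x]) (use a b pw_Sym in \<open>auto simp: swap_other\<close>)

lemma swap_Sym: "swap \<in> Sym N"
  by (rule involution_Sym) (simp_all add: swap_outside)

lemma swap_centralizer: "swap \<in> centralizer N \<pi>"
  by (simp add: centralizer_def swap_Sym swap_\<pi> fun_eq_iff)

lemma swap_neq: "swap \<noteq> id" "\<pi> \<circ> swap \<noteq> inv \<pi>"
proof -
  have "swap a = b" using swap_pw(1)[of 0] by simp
  then show "swap \<noteq> id" using distinct by auto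
  show "\<pi> \<circ> swap \<noteq> inv \<pi>"
  proof
    assume "\<pi> \<circ> swap = inv \<pi>"
    then have "\<pi> (swap a) = pw (L - 1) a" by (simp add: inv_\<pi> fun_eq_iff)
    then have "pw 1 b = pw (L - 1) a" using \<open>swap a = b\<close> by (simp add: pw_def)
    then have "b \<in> orb a" by (metis pw_in_orb_iff self_in_orb)
    then show False using distinct by simp
  qed
qed

lemma even_phase_swap: "x < N \<Longrightarrow> even (phase (swap x)) \<longleftrightarrow> even (phase x)"
proof (rule cases_orb[of x])
  fix k assume "x = pw k a"
  then show ?thesis using a b phase_pw_base[of a k] phase_pw_base[of b k]
    by (simp add: even_mod_L[of "phase (pw k a)" "phase (pw k b)"])
next
  fix k assume "x = pw k b"
  then show ?thesis using a b phase_pw_base[of a k] phase_pw_base[of b k]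
    by (simp add: even_mod_L[of "phase (pw k a)" "phase (pw k b)"])
qed (simp add: swap_other)

lemma even_phase_\<pi>: "x < N \<Longrightarrow> even (phase (\<pi> x)) \<longleftrightarrow> odd (phase x)"
  using phase_pw[of x 1] even_mod_L[of "phase (\<pi> x)" "phase x + 1"] by (simp add: pw_def)

lemma swap_less [simp]: "swap x < N \<longleftrightarrow> x < N"
  by (rule Sym_less_iff[OF swap_Sym])

lemma \<pi>_less [simp]: "\<pi> x < N \<longleftrightarrow> x < N"
  by (rule Sym_less_iff[OF \<pi>_Sym])

text \<open>\<open>swap\<close> preserves the parity of the phase and \<open>\<pi>\<close> reverses
  it. So in the conjugate of \<open>\<pi>\<close> exactly one of the two half swaps acts as
  \<open>swap\<close>, which commutes with \<open>\<pi>\<close>.\<close>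

lemma half_swap:
  "half_swap \<in> Sym N" "half_swap \<circ> half_swap = id"
  "half_swap \<circ> \<pi> \<circ> half_swap = \<pi> \<circ> swap" "half_swap \<circ> swap = swap \<circ> half_swap"
proof -
  have invol: "half_swap (half_swap x) = x" for x
    by (auto simp: half_swap_def even_phase_swap)
  then show "half_swap \<circ> half_swap = id" by auto
  show "half_swap \<in> Sym N"
    by (rule involution_Sym[OF invol]) (simp add: half_swap_def)
  show "half_swap \<circ> \<pi> \<circ> half_swap = \<pi> \<circ> swap"
  proof
    fix x show "(half_swap \<circ> \<pi> \<circ> half_swap) x = (\<pi> \<circ> swap) x"
      by (cases "x < N")
        (auto simp: half_swap_def even_phase_swap even_phase_\<pi> swap_\<pi> swap_outside)
  qed
  show "half_swap \<circ> swap = swap \<circ> half_swap"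
    by (auto simp: half_swap_def even_phase_swap fun_eq_iff)
qed

lemma reflect_pw: "base c = c \<Longrightarrow> reflect (pw k c) = pw ((L - 1) * k) c"
proof (cases "c < N")
  case True
  assume "base c = c"
  moreover have "((L - 1) * phase (pw k c)) mod L = ((L - 1) * k) mod L"
    using phase_pw_base[OF True \<open>base c = c\<close>] by (metis mod_mult_right_eq)
  ultimately show ?thesis using True by (simp add: reflect_def pw_eq_iff)
qed (simp add: reflect_def pw_outside)

text \<open>With \<open>L = p + 2\<close> the square of \<open>L - 1\<close> is
  \<open>1 + p * L\<close>, so two reflections restore the phase.\<close>

lemma square_mod: "pw ((L - 1) * ((L - 1) * k)) x = pw k x"
proof -
  obtain p where p: "L = p + 2" using L(1) by (metis add.commute le_Suc_ex numeral_le_iff order_trans semiring_norm(68,69,71))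
  have "(L - 1) * ((L - 1) * k) = k + (p * k) * L"
    unfolding p by (simp add: algebra_simps)
  then show ?thesis by (simp only: pw_simps(2)[symmetric] pw_mult_L)
qed

lemma cases_base: obtains k c where "x = pw k c" "base c = c"
  using pw_phase base_idem by metis

lemma reflect:
  "reflect \<in> Sym N" "reflect \<circ> reflect = id"
  "reflect \<circ> \<pi> \<circ> reflect = inv \<pi>" "reflect \<circ> swap = swap \<circ> reflect"
proof -
  have invol: "reflect (reflect x) = x" for x
    by (rule cases_base[of x]) (simp add: reflect_pw square_mod del: One_nat_def)
  then show "reflect \<circ> reflect = id" by auto
  show "reflect \<in> Sym N"
  proof (rule involution_Sym[OF invol])
    fix x assume "\<not> x < N"
    then show "reflect x = x"
      by (metis base_less pw_outside pw_phase reflect_def)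
  qed
  show "reflect \<circ> \<pi> \<circ> reflect = inv \<pi>"
  proof
    fix x
    obtain k c where x: "x = pw k c" "base c = c" by (rule cases_base)
    have "reflect (\<pi> (reflect x)) = pw ((L - 1) * ((L - 1) * k) + (L - 1)) c"
      by (simp add: x reflect_pw add.commute)
    also have "\<dots> = pw (L - 1) (pw ((L - 1) * ((L - 1) * k)) c)"
      by (simp only: pw_simps(2) add.commute)
    finally show "(reflect \<circ> \<pi> \<circ> reflect) x = inv \<pi> x"
      by (simp only: square_mod inv_\<pi> comp_apply x)
  qed
  show "reflect \<circ> swap = swap \<circ> reflect"
  proof
    fix x
    show "(reflect \<circ> swap) x = (swap \<circ> reflect) x"
    proof (rule cases_orb[of x])
      assume *: "x \<notin> orb a" "x \<notin> orb b"
      obtain k c where x: "x = pw k c" "base c = c" by (rule cases_base)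
      then show ?thesis using * by (simp add: reflect_pw swap_other)
    qed (simp_all add: reflect_pw)
  qed
qed

end

section \<open>Reduction of the centralizer to one cycle\<close>

lemma (in equal_cycles) \<pi>_neq_inv:
  assumes "x < N"
  shows "\<pi> \<noteq> inv \<pi>"
proof
  assume "\<pi> = inv \<pi>"
  then have "\<pi> x = inv \<pi> x" by (rule fun_cong)
  then have "pw 1 x = pw (L - 1) x" unfolding inv_\<pi> by (simp add: pw_def)
  \<comment> \<open>The residues 1 and \<open>L - 1\<close> differ because \<open>L\<close> is at
    least 4.\<close>
  then show False using L pw_eq_iff[OF assms, of 1 "L - 1"] by simp
qed

text \<open>Modulo the swaps every element of the centralizer is a power of one single cycle.\<close>

lemma (in equal_cycles) centralizer_reduce:
  assumes a0: "a\<^sub>0 < N" and \<gamma>: "\<gamma> \<in> centralizer N \<pi>"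
    and base: "\<And>\<gamma>. \<gamma> \<in> centralizer N \<pi> \<Longrightarrow> (\<And>x. x < N \<Longrightarrow> x \<notin> orb a\<^sub>0 \<Longrightarrow> \<gamma> x = x) \<Longrightarrow> P \<gamma>"
    and step: "\<And>\<gamma> a b. \<gamma> \<in> centralizer N \<pi> \<Longrightarrow> two_orbits N L \<pi> a b
      \<Longrightarrow> P (two_orbits.swap \<pi> a b \<circ> \<gamma>) \<Longrightarrow> P \<gamma>"
  shows "P \<gamma>"
  using \<gamma>
proof (induction "card {x. x < N \<and> x \<notin> orb a\<^sub>0 \<and> \<gamma> x \<noteq> x}" arbitrary: \<gamma> rule: less_induct)
  case less
  let ?M = "\<lambda>\<gamma>. {x. x < N \<and> x \<notin> orb a\<^sub>0 \<and> \<gamma> x \<noteq> x}"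
  have \<gamma>S: "\<gamma> \<in> Sym N" using less.prems by (simp add: centralizer_def)
  \<comment> \<open>If \<open>\<delta>\<close> carries the cycle of \<open>x\<close> to another
    cycle, swapping these two afterwards returns \<open>x\<close> to its place and disturbs no fixed
    point of \<open>\<delta>\<close>, so the count falls below that of
    \<open>\<gamma>\<close>.\<close>
  have decrease: "P \<delta>" if \<delta>: "\<delta> \<in> centralizer N \<pi>" and sub: "?M \<delta> \<subseteq> ?M \<gamma>"
    and x: "x < N" "x \<notin> orb a\<^sub>0" "\<gamma> x \<noteq> x" "\<delta> x \<notin> orb x" for \<delta> x
  proof -
    have \<delta>S: "\<delta> \<in> Sym N" using \<delta> by (simp add: centralizer_def)
    interpret two_orbits N L \<pi> x "\<delta> x"
      by unfold_locales (use x \<delta>S in auto)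
    have swap_x: "swap (\<delta> x) = x" using swap_pw(2)[of 0] by simp
    have fixed: "swap (\<delta> y) = y" if y: "\<delta> y = y" for y
    proof (rule cases_orb[of y])
      fix k assume "y = pw k x"
      then have "pw k (\<delta> x) = pw k x" using y centralizer_pw[OF \<delta>] by metis
      then show ?thesis using x(4) by (metis pw_in_orb_iff self_in_orb)
    next
      fix k assume k: "y = pw k (\<delta> x)"
      then have "\<delta> y = \<delta> (pw k x)" using y centralizer_pw[OF \<delta>] by metis
      then have "y = pw k x" using Sym_inverses(2)[OF \<delta>S] by metis
      then show ?thesis using k x(4) by (metis pw_in_orb_iff self_in_orb)
    qed (simp add: swap_other y)
    have "?M (swap \<circ> \<delta>) \<subset> ?M \<gamma>"
    proof
      show "?M (swap \<circ> \<delta>) \<subseteq> ?M \<gamma>" using fixed sub by auto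
      show "?M (swap \<circ> \<delta>) \<noteq> ?M \<gamma>" using x swap_x by auto
    qed
    then have "card (?M (swap \<circ> \<delta>)) < card (?M \<gamma>)" by (intro psubset_card_mono) auto
    then have "P (swap \<circ> \<delta>)"
      by (rule less.hyps) (rule centralizer_comp[OF swap_centralizer \<delta>])
    then show ?thesis by (rule step[OF \<delta> two_orbits_axioms])
  qed
  show ?case
  proof (cases "?M \<gamma> = {}")
    case True
    then show ?thesis by (intro base less.prems) auto
  next
    case False
    then obtain x where x: "x < N" "x \<notin> orb a\<^sub>0" "\<gamma> x \<noteq> x" by auto
    show ?thesis
    proof (cases "\<gamma> x \<in> orb x")
      case False
      then show ?thesis using decrease[OF less.prems order_refl x] by blast
    next
      case True
      then obtain j where j: "\<gamma> x = pw j x" by (auto simp: orb_def)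
      \<comment> \<open>Here \<open>\<gamma>\<close> rotates the cycle of \<open>x\<close>. A swap
        with the cycle of \<open>a\<^sub>0\<close> makes \<open>x\<close> leave its cycle, so that
        \<open>decrease\<close> applies. Points newly moved by this swap lie in the orbit of
        \<open>a\<^sub>0\<close>, which is not counted.\<close>
      interpret two_orbits N L \<pi> x a\<^sub>0
        by unfold_locales (use x a0 in_orb_sym in auto)
      have \<delta>: "swap \<circ> \<gamma> \<in> centralizer N \<pi>"
        by (rule centralizer_comp[OF swap_centralizer less.prems])
      have "P (swap \<circ> \<gamma>)"
      proof (rule decrease[OF \<delta> _ x])
        show "(swap \<circ> \<gamma>) x \<notin> orb x" using distinct by (simp add: j)
        have "swap (\<gamma> y) = y" if y: "\<gamma> y = y" "y \<notin> orb a\<^sub>0" for y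
        proof (rule cases_orb[of y])
          fix k assume "y = pw k x"
          then have "pw k (pw j x) = pw k x"
            using y centralizer_pw[OF less.prems, of k x] j by simp
          then have "pw j x = x" using Sym_inverses(2)[OF pw_Sym] by metis
          then show ?thesis using x j by simp
        qed (use y in \<open>auto simp: swap_other\<close>)
        then show "?M (swap \<circ> \<gamma>) \<subseteq> ?M \<gamma>" by auto
      qed
      then show ?thesis by (rule step[OF less.prems two_orbits_axioms])
    qed
  qed
qed

section \<open>Degree one when all swaps act by scalars\<close>

locale equal_cycles_irrep = equal_cycles N L \<pi> + centralizer_irrep N \<pi> d \<rho>
  for N L \<pi> d \<rho>
begin

lemma nonscalar_swap_exists:
  assumes "1 < d" and a0: "a\<^sub>0 < N"
  shows "\<exists>a b. two_orbits N L \<pi> a b \<and>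
    (\<forall>c. \<exists>v\<in>cvec d. act (two_orbits.swap \<pi> a b) v \<noteq> (\<lambda>i. c * v i))"
proof -
  \<comment> \<open>If all swaps are scalar, an eigenvector of the single cycle \<open>A\<close>
    spans a line invariant under the whole centralizer, by
    \<open>centralizer_reduce\<close>.\<close>
  have False if scalar: "\<And>a b. two_orbits N L \<pi> a b \<Longrightarrow>
    \<exists>c. \<forall>v\<in>cvec d. act (two_orbits.swap \<pi> a b) v = (\<lambda>i. c * v i)"
  proof -
    define A where "A = (\<lambda>x. if x \<in> orb a\<^sub>0 then \<pi> x else x)"
    have \<pi>_orb: "\<pi> x \<in> orb y \<longleftrightarrow> x \<in> orb y" for x y
      using pw_in_orb_iff[of 1 x y] by (simp add: pw_def)
    have A_pow: "(A ^^ k) x = (if x \<in> orb a\<^sub>0 then pw k x else x)" for k x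
      by (induction k) (auto simp: A_def)
    have A_L: "A ^^ L = id" by (auto simp: A_pow fun_eq_iff)
    have "A \<in> Sym N"
    proof -
      have "A \<circ> A ^^ (L - 1) = id" "A ^^ (L - 1) \<circ> A = id"
        using A_L L funpow.simps(2)[of "L - 1" A] funpow_Suc_right[of "L - 1" A] by simp_all
      then have "bij A" by (metis o_bij)
      moreover have "A x = x" if "x \<notin> {..<N}" for x
        using that Sym_outside[OF \<pi>_Sym, of x] by (auto simp: A_def)
      ultimately show ?thesis
        by (simp add: Sym_def permutes_def bij_iff)
    qed
    then have A: "A \<in> Z"
      by (auto simp: centralizer_def A_def \<pi>_orb fun_eq_iff)
    obtain v c where v: "v \<in> cvec d" "v \<noteq> (\<lambda>_. 0)" "act A v = (\<lambda>i. c * v i)"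
      by (rule eigenvector_exists[OF A _ A_L]) (use L in auto)
    have A_pow_act: "A ^^ k \<in> Z \<and> act (A ^^ k) v = (\<lambda>i. c ^ k * v i)" for k
    proof (induction k)
      case 0
      have "id \<in> Z" by (simp add: centralizer_def Sym_id)
      then show ?case using act_id[OF v(1)] by (simp add: id_def)
    next
      case (Suc k)
      then have "act (A \<circ> A ^^ k) v = (\<lambda>i. c ^ k * (c * v i))"
        by (simp only: act_comp[OF A] act_scale v(3))
      then show ?case using centralizer_comp[OF A, of "A ^^ k"] Suc
        by (simp only: funpow.simps power_Suc2 mult.assoc)
    qed
    have "\<exists>e. act \<gamma> v = (\<lambda>i. e * v i)" if "\<gamma> \<in> Z" for \<gamma>
    proof (rule centralizer_reduce[OF a0 that])
      fix \<gamma> assume \<gamma>: "\<gamma> \<in> Z" and fix_off: "\<And>x. x < N \<Longrightarrow> x \<notin> orb a\<^sub>0 \<Longrightarrow> \<gamma> x = x"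
      have \<gamma>S: "\<gamma> \<in> Sym N" using \<gamma> by (simp add: centralizer_def)
      \<comment> \<open>Otherwise \<open>\<gamma>\<close> fixes the point
        \<open>\<gamma> a\<^sub>0\<close>, and injectivity makes \<open>a\<^sub>0\<close> itself
        fixed.\<close>
      have "\<gamma> a\<^sub>0 \<in> orb a\<^sub>0"
      proof (rule ccontr)
        assume *: "\<gamma> a\<^sub>0 \<notin> orb a\<^sub>0"
        then have "\<gamma> (\<gamma> a\<^sub>0) = \<gamma> a\<^sub>0" using fix_off a0 \<gamma>S by simp
        then have "\<gamma> a\<^sub>0 = a\<^sub>0" using Sym_inverses(2)[OF \<gamma>S] by metis
        then show False using * by simp
      qed
      then obtain k where k: "\<gamma> a\<^sub>0 = pw k a\<^sub>0" by (auto simp: orb_def)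
      \<comment> \<open>Commuting with \<open>\<pi>\<close>, the permutation \<open>\<gamma>\<close>
        is determined on a cycle by its value at one point.\<close>
      have "\<gamma> = A ^^ k"
      proof
        fix x
        consider j where "x = pw j a\<^sub>0" | "x \<notin> orb a\<^sub>0" "x < N" | "x \<notin> orb a\<^sub>0" "\<not> x < N"
          by (auto simp: orb_def)
        then show "\<gamma> x = (A ^^ k) x"
        proof cases
          case 1
          then show ?thesis by (simp add: centralizer_pw[OF \<gamma>] k A_pow add.commute)
        qed (use fix_off Sym_outside[OF \<gamma>S] in \<open>auto simp: A_pow\<close>)
      qed
      then show "\<exists>e. act \<gamma> v = (\<lambda>i. e * v i)" using A_pow_act by blast
    next
      fix \<gamma> a b assume \<gamma>: "\<gamma> \<in> Z" and "two_orbits N L \<pi> a b"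
        and IH: "\<exists>e. act (two_orbits.swap \<pi> a b \<circ> \<gamma>) v = (\<lambda>i. e * v i)"
      interpret two_orbits N L \<pi> a b by fact
      obtain e where e: "act (swap \<circ> \<gamma>) v = (\<lambda>i. e * v i)" using IH by blast
      obtain c' where c': "\<And>v. v \<in> cvec d \<Longrightarrow> act swap v = (\<lambda>i. c' * v i)"
        using scalar[OF two_orbits_axioms] by blast
      have "swap \<circ> (swap \<circ> \<gamma>) = \<gamma>" by auto
      then have "act \<gamma> v = act swap (act (swap \<circ> \<gamma>) v)"
        using act_comp[OF swap_centralizer centralizer_comp[OF swap_centralizer \<gamma>]] by metis
      also have "\<dots> = (\<lambda>i. c' * e * v i)"
        unfolding e using c'[OF cvec_scale[OF v(1)]] by (simp add: mult.assoc)
      finally show "\<exists>e. act \<gamma> v = (\<lambda>i. e * v i)" by blast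
    qed
    then have "d = 1" by (rule invariant_line_degree_one[OF v(1,2)])
    then show False using assms(1) by simp
  qed
  then show ?thesis by blast
qed

end

section \<open>Case distinction on the scalar by which the permutation acts\<close>

theorem theorem2p14:
  fixes r n d :: nat and \<pi> :: perm and \<rho> :: "perm \<Rightarrow> nat \<Rightarrow> nat \<Rightarrow> complex"
    and g :: "perm \<Rightarrow> perm"
  assumes "r \<ge> 2" and "n \<ge> 2"
    and "cycle_type_2r r n \<pi>"
    and "irreducible_rep (centralizer (2*r*n) \<pi>) d \<rho>"
    and "d > 1"
    and "\<forall>t\<in>conj_class (2*r*n) \<pi>. g t \<in> Sym (2*r*n) \<and> g t \<circ> \<pi> \<circ> inv (g t) = t"
  shows "nichols_dim (conj_class (2*r*n) \<pi>) d g \<rho> = \<infinity>"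
proof -
  let ?N = "2 * r * n"
  interpret equal_cycles_irrep ?N "2 * r" \<pi> d \<rho>
    by unfold_locales (use assms in \<open>auto simp: cycle_type_2r_def\<close>)
  interpret yetter_drinfeld_irrep ?N \<pi> d \<rho> g
    by unfold_locales (use assms in auto)
  have pos: "0 < ?N" using assms by simp
  obtain a b where "two_orbits ?N (2 * r) \<pi> a b"
    and nonscalar: "\<And>c. \<exists>v\<in>cvec d. act (two_orbits.swap \<pi> a b) v \<noteq> (\<lambda>i. c * v i)"
    using nonscalar_swap_exists[OF assms(5) pos] by blast
  then interpret two_orbits ?N "2 * r" \<pi> a b by simp
  \<comment> \<open>The permutation \<open>\<pi>\<close> is central in its own centralizer, so
    Schur's lemma applies to it.\<close>
  obtain c where c: "\<And>v. v \<in> cvec d \<Longrightarrow> act \<pi> v = (\<lambda>i. c * v i)"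
    by (rule central_acts_by_scalar[OF s_in_centralizer _ \<pi>_power_L])
      (use L in \<open>auto simp: centralizer_def\<close>)
  show ?thesis
  proof (cases "c = -1")
    case False
    have "inv reflect = reflect" using reflect(2) by (intro inv_unique_comp)
    then show ?thesis
      using nichols_dim_infinite_not_minus_one[OF reflect(1) _ \<pi>_neq_inv[OF a] c False] reflect(3)
      by simp
  next
    case True
    then have "act \<pi> v = (\<lambda>i. - v i)" if "v \<in> cvec d" for v using c[OF that] by simp
    then show ?thesis
      by (intro nichols_dim_infinite_minus_one[OF swap_centralizer _ \<pi>_neq_inv[OF a] nonscalar
            swap_neq half_swap reflect]) auto
  qed
qed

end
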